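(* Let $L$ be a line in $\mathbb{K}P^3$ such that $L\cap Q(\mathbb{K})$ consists of exactly two points. Then $\operatorname{VAL}(L)$ is equal to one of the following sets: (iii) $\{r\}\times\sigma(l\setminus\{p,q\})\ \cup\ ((r,\infty)\cap\mathbb{Q})\times\mathcal{S}|_{\{p,q\}}\ \cup\ \{\infty\}\times\{p,q\}$, where $r>0$, $l$ is a line contained in $Q(\mathbb{C})$, $p,q$ are distinct points of $l$, and $\sigma$ is a section of $\mathcal{S}$ over $l\setminus\{p,q\}$; (iv) $\{0\}\times\varkappa^\circ(l\setminus\{p,q\})\ \cup\ ((0,\infty)\cap\mathbb{Q})\times\mathcal{S}|_{\{p,q\}}\ \cup\ \{\infty\}\times\{p,q\}$, where $l$ is a line in $\mathbb{C}P^3$ intersecting $Q(\mathbb{C})$ in two points $p$ and $q$; (i) $\{r\}\times\sigma(l\setminus\{p\})\ \cup\ ((r,\infty)\cap\mathbb{Q})\times\mathcal{S}|_{\{p\}}\ \cup\ \{\infty\}\times\{p\}$, where $r>0$, $l$ is a line contained in $Q(\mathbb{C})$, $p\in l$, and $\sigma$ is a section of $\mathcal{S}$ over $l\setminus\{p\}$; or (ii) $\{0\}\times\varkappa^\circ(l\setminus\{p\})\ \cup\ ((0,\infty)\cap\mathbb{Q})\times\mathcal{S}|_{\{p\}}\ \cup\ \{\infty\}\times\{p\}$, where $l$ is a line in $\mathbb{C}P^3$ tangent to $Q(\mathbb{C})$ at the point $p$.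
   Context: Matrices and classes. For a $2\times 2$ matrix $B=\begin{pmatrix}a&b\\ c&d\end{pmatrix}$ write $B^{\mathbf c}=\begin{pmatrix}d&-b\\ -c&a\end{pmatrix}$; $B^*$ is the conjugate transpose. $\mathbb{C}P^3$ is the projectivization of the space of complex $2\times2$ matrices; $[B]_{\mathbb{C}^*}$ is the class of a nonzero matrix up to nonzero complex scalars, $[B]_{\mathbb{R}^*}$ its class up to nonzero real scalars. $Q(\mathbb{C})=\{[B]_{\mathbb{C}^*}:\det B=0\}$, $PSL_2(\mathbb{C})=\mathbb{C}P^3\setminus Q(\mathbb{C})$, $PSU(2)=\{[U]_{\mathbb{C}^*}:U\in SU(2)\}$. The spherical coamoeba map $\varkappa^\circ\colon PSL_2(\mathbb{C})\to PSU(2)$ sends $[A]_{\mathbb{C}^*}$ with $\det A=1$ to $[A+(A^{\mathbf c})^*]_{\mathbb{R}^*}$ (the class of the unitary factor of the polar decomposition of $A$). Circle bundle. $\mathcal{S}$ is the set of classes $[B]_{\mathbb{R}^*}$ of complex $2\times2$ matrices of rank one, with projection $\pi\colon\mathcal{S}\to Q(\mathbb{C})$, $[B]_{\mathbb{R}^*}\mapsto[B]_{\mathbb{C}^*}$; for $Z\subset Q(\mathbb{C})$, $\mathcal{S}|_Z=\pi^{-1}(Z)$, and a section of $\mathcal{S}$ over $Z$ is a continuous map $\sigma\colon Z\to\mathcal{S}$ with $\pi\circ\sigma=\mathrm{id}_Z$. Cone notation (all sets are subsets of $\mathbb{C}P^3$). For $I\subset(0,\infty)$ and $T\subset\mathcal{S}$,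 $I\times T:=\{[e^\alpha B+e^{-\alpha}(B^{\mathbf c})^*]_{\mathbb{C}^*}:\alpha\in I,\ [B]_{\mathbb{R}^*}\in T\}$; for $X\subset PSU(2)$, $\{0\}\times X:=X$; for $Y\subset Q(\mathbb{C})$, $\{\infty\}\times Y:=Y$. Field and valuation. $\mathbb{K}$ is the field of Puiseux series in $t$ (with $t\to\infty$) with complex coefficients, i.e. series $\sum_q a_q t^q$ with $a_q\in\mathbb{C}$ and exponents in $\frac1N\mathbb{Z}$ for some $N\ge1$, bounded above; it is algebraically closed. $\mathbb{K}P^3$ is the projectivization of the space of $2\times 2$ matrices over $\mathbb{K}$, and $Q(\mathbb{K})\subset\mathbb{K}P^3$ the quadric $\det=0$. Every nonzero matrix $A$ over $\mathbb{K}$ can be written uniquely as $A=t^\alpha B+(\text{terms with exponents}<\alpha)$ with $\alpha\in\mathbb{Q}$ and $B$ a nonzero complex matrix. The map $\operatorname{VAL}\colon\mathbb{K}P^3\to\mathbb{C}P^3$ is: if $\det A=0$, $\operatorname{VAL}([A])=[B]_{\mathbb{C}^*}$; if $\det A\ne0$, rescale $A$ so that $\det A=1$ (then $\alpha\ge0$), and set $\operatorname{VAL}([A])=[e^\alpha B+e^{-\alpha}(B^{\mathbf c})^*]_{\mathbb{C}^*}$. *)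

theory Defs
  imports "HOL-Analysis.Analysis"
begin

text \<open>A complex 2x2 matrix (a b; c d) is the tuple (a,b,c,d); this type carries
  the Euclidean topology (product topology on C^4) and componentwise addition
  and real scaling.\<close>

type_synonym cmat = "complex \<times> complex \<times> complex \<times> complex"

fun cdet :: "cmat \<Rightarrow> complex" where
  "cdet (a,b,c,d) = a*d - b*c"

fun cadj :: "cmat \<Rightarrow> cmat" where
  "cadj (a,b,c,d) = (d, -b, -c, a)"

fun cctr :: "cmat \<Rightarrow> cmat" where
  "cctr (a,b,c,d) = (cnj a, cnj c, cnj b, cnj d)"

fun cscale :: "complex \<Rightarrow> cmat \<Rightarrow> cmat" where
  "cscale s (a,b,c,d) = (s*a, s*b, s*c, s*d)"

fun cmmul :: "cmat \<Rightarrow> cmat \<Rightarrow> cmat" where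
  "cmmul (a,b,c,d) (a',b',c',d') = (a*a'+b*c', a*b'+b*d', c*a'+d*c', c*b'+d*d')"

definition cid :: cmat where "cid = (1,0,0,1)"

definition SU2 :: "cmat set" where
  "SU2 = {U. cmmul (cctr U) U = cid \<and> cdet U = 1}"

definition cclass :: "cmat \<Rightarrow> cmat set" where
  "cclass B = {cscale s B | s. s \<noteq> 0}"

definition rclass :: "cmat \<Rightarrow> cmat set" where
  "rclass B = {r *\<^sub>R B | r. r \<noteq> 0}"

definition CP3 :: "cmat set set" where
  "CP3 = {cclass B | B. B \<noteq> 0}"

definition QC :: "cmat set set" where
  "QC = {cclass B | B. B \<noteq> 0 \<and> cdet B = 0}"

definition PSL2 :: "cmat set set" where
  "PSL2 = CP3 - QC"

definition PSU2 :: "cmat set set" where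
  "PSU2 = {cclass U | U. U \<in> SU2}"

definition kappa :: "cmat set \<Rightarrow> cmat set" where
  "kappa P = (let A = (SOME A. A \<in> P \<and> cdet A = 1) in cclass (A + cctr (cadj A)))"

definition Sb :: "cmat set set" where
  "Sb = {rclass B | B. B \<noteq> 0 \<and> cdet B = 0}"

definition piS :: "cmat set \<Rightarrow> cmat set" where
  "piS T = cclass (SOME B. B \<in> T)"

definition Srestr :: "cmat set set \<Rightarrow> cmat set set" where
  "Srestr Z = {T \<in> Sb. piS T \<in> Z}"

definition qtop :: "cmat set \<Rightarrow> (cmat \<Rightarrow> cmat set) \<Rightarrow> cmat set topology" where
  "qtop A cls = topology (\<lambda>U. U \<subseteq> cls ` A \<and>
       openin (top_of_set A) {x \<in> A. cls x \<in> U})"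

definition CPtop :: "cmat set topology" where
  "CPtop = qtop (- {0}) cclass"

definition Stop :: "cmat set topology" where
  "Stop = qtop {B. B \<noteq> 0 \<and> cdet B = 0} rclass"

definition is_section :: "(cmat set \<Rightarrow> cmat set) \<Rightarrow> cmat set set \<Rightarrow> bool" where
  "is_section \<sigma> Z \<longleftrightarrow> Z \<subseteq> QC \<and> continuous_map (subtopology CPtop Z) Stop \<sigma> \<and>
     (\<forall>z\<in>Z. \<sigma> z \<in> Sb \<and> piS (\<sigma> z) = z)"

definition cone :: "real set \<Rightarrow> cmat set set \<Rightarrow> cmat set set" where
  "cone I T = {cclass (exp \<alpha> *\<^sub>R B + exp (-\<alpha>) *\<^sub>R cctr (cadj B)) | \<alpha> B.
                 \<alpha> \<in> I \<and> rclass B \<in> T}"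

definition cline :: "cmat \<Rightarrow> cmat \<Rightarrow> cmat set set" where
  "cline A B = {cclass (cscale u A + cscale v B) | u v. (u, v) \<noteq> (0, 0)}"

definition is_cline :: "cmat set set \<Rightarrow> bool" where
  "is_cline l \<longleftrightarrow> (\<exists>A B. (\<forall>u v. cscale u A + cscale v B = 0 \<longrightarrow> u = 0 \<and> v = 0)
                      \<and> l = cline A B)"

text \<open>Polar bilinear form of det (det X = cpol X X / 2) and tangency.\<close>
fun cpol :: "cmat \<Rightarrow> cmat \<Rightarrow> complex" where
  "cpol (a,b,c,d) (a',b',c',d') = a*d' + d*a' - b*c' - c*b'"

definition tangent_at :: "cmat set set \<Rightarrow> cmat set \<Rightarrow> bool" where
  "tangent_at l p \<longleftrightarrow> is_cline l \<and> p \<in> l \<and> p \<in> QC \<and>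
     (\<forall>X\<in>l. \<forall>A\<in>p. \<forall>B\<in>X. cpol A B = 0)"

text \<open>A Puiseux series is represented by its coefficient function on exponents.\<close>
type_synonym kser = "rat \<Rightarrow> complex"

definition puiseux :: "kser \<Rightarrow> bool" where
  "puiseux f \<longleftrightarrow> (\<exists>N::nat. N > 0 \<and> (\<forall>q. f q \<noteq> 0 \<longrightarrow> q * of_nat N \<in> \<int>)) \<and>
                  bdd_above {q. f q \<noteq> 0}"

definition kzero :: kser where "kzero = (\<lambda>_. 0)"
definition kone :: kser where "kone = (\<lambda>q. if q = 0 then 1 else 0)"
definition kadd :: "kser \<Rightarrow> kser \<Rightarrow> kser" where "kadd f g = (\<lambda>q. f q + g q)"
definition kneg :: "kser \<Rightarrow> kser" where "kneg f = (\<lambda>q. - f q)"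
definition kmul :: "kser \<Rightarrow> kser \<Rightarrow> kser" where
  "kmul f g = (\<lambda>q. \<Sum>a \<in> {a. f a \<noteq> 0 \<and> g (q - a) \<noteq> 0}. f a * g (q - a))"

type_synonym kmat = "kser \<times> kser \<times> kser \<times> kser"

fun kmat_ok :: "kmat \<Rightarrow> bool" where
  "kmat_ok (a,b,c,d) \<longleftrightarrow> puiseux a \<and> puiseux b \<and> puiseux c \<and> puiseux d"

definition kmzero :: kmat where "kmzero = (kzero, kzero, kzero, kzero)"

fun kdet :: "kmat \<Rightarrow> kser" where
  "kdet (a,b,c,d) = kadd (kmul a d) (kneg (kmul b c))"

fun kscale :: "kser \<Rightarrow> kmat \<Rightarrow> kmat" where
  "kscale s (a,b,c,d) = (kmul s a, kmul s b, kmul s c, kmul s d)"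

fun kmadd :: "kmat \<Rightarrow> kmat \<Rightarrow> kmat" where
  "kmadd (a,b,c,d) (a',b',c',d') = (kadd a a', kadd b b', kadd c c', kadd d d')"

definition kclass :: "kmat \<Rightarrow> kmat set" where
  "kclass A = {kscale s A | s. puiseux s \<and> s \<noteq> kzero}"

definition QK :: "kmat set set" where
  "QK = {kclass A | A. kmat_ok A \<and> A \<noteq> kmzero \<and> kdet A = kzero}"

definition is_kline :: "kmat set set \<Rightarrow> bool" where
  "is_kline L \<longleftrightarrow> (\<exists>A B. kmat_ok A \<and> kmat_ok B \<and>
     (\<forall>u v. puiseux u \<and> puiseux v \<and> kmadd (kscale u A) (kscale v B) = kmzero
              \<longrightarrow> u = kzero \<and> v = kzero) \<and>
     L = {kclass (kmadd (kscale u A) (kscale v B)) | u v.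
            puiseux u \<and> puiseux v \<and> (u, v) \<noteq> (kzero, kzero)})"

fun kents :: "kmat \<Rightarrow> kser list" where
  "kents (a,b,c,d) = [a,b,c,d]"

definition lead_exp :: "kmat \<Rightarrow> rat" where
  "lead_exp A = (GREATEST q. \<exists>e \<in> set (kents A). e q \<noteq> 0)"

fun coef_at :: "rat \<Rightarrow> kmat \<Rightarrow> cmat" where
  "coef_at q (a,b,c,d) = (a q, b q, c q, d q)"

definition lead_coef :: "kmat \<Rightarrow> cmat" where
  "lead_coef A = coef_at (lead_exp A) A"

definition VALm :: "kmat \<Rightarrow> cmat set" where
  "VALm A = (if kdet A = kzero then cclass (lead_coef A)
     else (let A' = (SOME A'. \<exists>s. puiseux s \<and> s \<noteq> kzero \<and> A' = kscale s A \<and> kdet A' = kone);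
               \<alpha> = real_of_rat (lead_exp A'); B = lead_coef A'
           in cclass (exp \<alpha> *\<^sub>R B + exp (-\<alpha>) *\<^sub>R cctr (cadj B))))"

definition VALp :: "kmat set \<Rightarrow> cmat set" where
  "VALp P = VALm (SOME A. A \<in> P)"

end

theory Submission
  imports Defs "HOL-Computational_Algebra.Formal_Laurent_Series"
begin

text \<open>
  The restriction of det to the plane over $L$ is a binary quadratic form with two distinct zeros.
  Choose a basis $A, E$ of the plane with $\det A = 0$ whose leading matrices $A_0, E_0$ sit at
  exponent 0 and are linearly independent; then $\det(xA + yE) = y(cx + gy)$. Let $-2\rho$ be the
  larger leading exponent of $c$ and $g$, and $q_0(x,y) = y(c_0 x + g_0 y)$ the nonzero complex form
  cut out by it, with zeros $p$ and $q$ on the line $l$ through $A_0$ and $E_0$. A point with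
  leading coordinates $(x_0,y_0)$ off the zeros has level exactly $\rho$ and phase
  $(x_0A_0 + y_0E_0)/\sqrt{q_0(x_0,y_0)}$, which is the section (or the spherical coamoeba map if
  $\rho = 0$). Points reducing to $p$ or $q$ have larger level, and every rational level above
  $\rho$ with every phase is attained because $y(cx + gy) = W$ can be solved near a zero of $q_0$.
  Whether $p = q$ distinguishes the tangent from the transversal cases.
\<close>

section \<open>The field of Puiseux series\<close>

unbundle fps_syntax

text \<open>Independence of \<open>A0\<close> and \<open>E0\<close> excludes cancellation: for
  coordinates normalised to leading exponent 0 and not both vanishing there, the leading matrix of
  xA + yE is x0 A0 + y0 E0. The two isotropic generators given by the two points of L on the quadric
  need not have this property, since they reduce to the same point when p = q. Hence only one of
  them is kept, which accounts for the asymmetric form y(cx + gy). The level comes from the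
  normalisation det = 1: if X has leading exponent \<mu> and det X has leading exponent \<omega>,
  dividing X by a square root of det X gives level \<mu> - \<omega>/2; this is \<rho> for \<mu> = 0
  and \<omega> = -2\<rho>. A square root is fixed only up to sign, while points of the circle bundle
  are classes up to real scalars. So the choices made by \<open>SOME\<close> and
  \<open>csqrt\<close> do no harm to the values; the branch cut of \<open>csqrt\<close> matters only
  for the continuity of the section. Square roots of Puiseux series enter twice: in normalising the
  determinant and in solving the quadratic equation near a double zero.\<close>

text \<open>The series in $t^{1/N}$ whose coefficient at $t^{-n/N}$ is the $n$-th coefficient of the
  Laurent series: exponents are bounded above here, but below there.\<close>

definition puis :: "nat \<Rightarrow> complex fls \<Rightarrow> kser" where
  "puis N F = (\<lambda>q. if q * of_nat N \<in> \<int> then F $$ (- \<lfloor>q * of_nat N\<rfloor>) else 0)"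

lemma puiseux_puis:
  assumes "N > 0"
  shows "puiseux (puis N F)"
proof -
  obtain K :: int where K: "\<forall>n<K. F $$ n = 0"
    by (elim fls_nth_vanishes_belowE)
  have "q \<le> of_int (-K) / of_nat N" if "puis N F q \<noteq> 0" for q
  proof -
    from that have "q * of_nat N \<in> \<int>" "- \<lfloor>q * of_nat N\<rfloor> \<ge> K"
      using K by (auto simp: puis_def not_less[symmetric] split: if_splits)
    then have "q * of_nat N \<le> of_int (-K)"
      by (auto elim!: Ints_cases simp flip: of_int_minus simp del: of_int_minus)
    then show ?thesis
      using assms by (simp add: field_simps)
  qed
  then have "bdd_above {q. puis N F q \<noteq> 0}"
    by (intro bdd_aboveI) blast
  moreover have "q * of_nat N \<in> \<int>" if "puis N F q \<noteq> 0" for q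
    using that by (auto simp: puis_def split: if_splits)
  ultimately show ?thesis
    using assms unfolding puiseux_def by blast
qed

lemma puiseux_eq_puis:
  assumes "bdd_above {q. f q \<noteq> 0}" "N > 0" "\<And>q. f q \<noteq> 0 \<Longrightarrow> q * of_nat N \<in> \<int>"
  obtains F where "f = puis N F"
proof -
  obtain b where b: "\<And>q. f q \<noteq> 0 \<Longrightarrow> q \<le> b"
    using assms(1) by (auto simp: bdd_above_def)
  define F where "F = Abs_fls (\<lambda>n::int. f (- of_int n / of_nat N))"
  have "f (- of_int n / of_nat N) = 0" if "n < - \<lceil>b * of_nat N\<rceil>" for n
  proof (rule ccontr)
    assume "f (- of_int n / of_nat N) \<noteq> 0"
    then have "- of_int n \<le> b * of_nat N"
      using b assms(2) by (fastforce simp: field_simps)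
    then show False
      using that by linarith
  qed
  then have F: "F $$ n = f (- of_int n / of_nat N)" for n
    unfolding F_def by (intro nth_Abs_fls_ex_lower_bound) blast
  have "f q = puis N F q" for q
  proof (cases "q * of_nat N \<in> \<int>")
    case True
    then obtain m :: int where "q * of_nat N = of_int m"
      by (auto elim: Ints_cases)
    moreover from this have "q = of_int m / of_nat N"
      using assms(2) by (simp add: field_simps)
    ultimately show ?thesis
      by (simp add: puis_def F)
  next
    case False
    then show ?thesis
      using assms(3) by (auto simp: puis_def)
  qed
  then show ?thesis
    using that by blast
qed

text \<open>Three series at once suffice for the associative and distributive laws; the product of
  the three denominators is a common one.\<close>

lemma puiseux_common:
  assumes "puiseux f" "puiseux g" "puiseux h"
  obtains N F G H where "N > 0" "f = puis N F" "g = puis N G" "h = puis N H"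
proof -
  obtain a where a: "a > 0" "\<And>q. f q \<noteq> 0 \<Longrightarrow> q * of_nat a \<in> \<int>"
    and fb: "bdd_above {q. f q \<noteq> 0}" using assms(1) unfolding puiseux_def by blast
  obtain b where b: "b > 0" "\<And>q. g q \<noteq> 0 \<Longrightarrow> q * of_nat b \<in> \<int>"
    and gb: "bdd_above {q. g q \<noteq> 0}" using assms(2) unfolding puiseux_def by blast
  obtain c where c: "c > 0" "\<And>q. h q \<noteq> 0 \<Longrightarrow> q * of_nat c \<in> \<int>"
    and hb: "bdd_above {q. h q \<noteq> 0}" using assms(3) unfolding puiseux_def by blast
  define N where "N = a * b * c"
  have N: "N > 0" using a b c by (simp add: N_def)
  have *: "q * of_nat N \<in> \<int>" if "q * of_nat k \<in> \<int>" "N = k * l" for q :: rat and k l :: nat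
    using Ints_mult[OF that(1), of "of_nat l"] that(2) by (simp add: algebra_simps)
  have "q * of_nat N \<in> \<int>" if "f q \<noteq> 0" for q
    by (rule *[OF a(2)[OF that], of "b * c"]) (simp add: N_def)
  moreover have "q * of_nat N \<in> \<int>" if "g q \<noteq> 0" for q
    by (rule *[OF b(2)[OF that], of "a * c"]) (simp add: N_def)
  moreover have "q * of_nat N \<in> \<int>" if "h q \<noteq> 0" for q
    by (rule *[OF c(2)[OF that], of "a * b"]) (simp add: N_def)
  ultimately show ?thesis
    using puiseux_eq_puis[OF fb N] puiseux_eq_puis[OF gb N] puiseux_eq_puis[OF hb N] N that
    by metis
qed

lemma kadd_puis: "kadd (puis N F) (puis N G) = puis N (F + G)"
  by (auto simp: kadd_def puis_def)

lemma kneg_puis: "kneg (puis N F) = puis N (- F)"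
  by (auto simp: kneg_def puis_def)

text \<open>Under the reindexing \<open>i\<close> to \<open>- i / N\<close> of exponents, the
  convolution over pairs in the supports becomes the Cauchy product of Laurent series.\<close>

lemma kmul_puis:
  assumes "N > 0"
  shows "kmul (puis N F) (puis N G) = puis N (F * G)"
proof
  fix q :: rat
  let ?S = "{a. puis N F a \<noteq> 0 \<and> puis N G (q - a) \<noteq> 0}"
  show "kmul (puis N F) (puis N G) q = puis N (F * G) q"
  proof (cases "q * of_nat N \<in> \<int>")
    case False
    have "?S = {}"
    proof (rule ccontr)
      assume "?S \<noteq> {}"
      then obtain a where "a * of_nat N \<in> \<int>" "(q - a) * of_nat N \<in> \<int>"
        by (auto simp: puis_def split: if_splits)
      then have "a * of_nat N + (q - a) * of_nat N \<in> \<int>"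
        by (rule Ints_add)
      then show False
        using False by (simp add: algebra_simps)
    qed
    moreover have "puis N (F * G) q = 0"
      using False by (simp add: puis_def)
    ultimately show ?thesis
      unfolding kmul_def by (simp only: sum.empty)
  next
    case True
    then obtain m :: int where m: "q * of_nat N = of_int (-m)"
      by (metis Ints_cases minus_minus)
    then have q: "q = - of_int m / of_nat N"
      using assms by (simp add: field_simps)
    let ?\<phi> = "\<lambda>i::int. - of_int i / of_nat N :: rat"
    let ?I = "{fls_subdegree F..m - fls_subdegree G}"
    have inj: "inj_on ?\<phi> UNIV"
      using assms by (auto intro!: injI)
    have F: "puis N F (?\<phi> i) = F $$ i" for i
      using assms by (simp add: puis_def)
    have "(q - ?\<phi> i) * of_nat N = of_int (i - m)" for i
      using assms by (simp add: q field_simps)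
    then have G: "puis N G (q - ?\<phi> i) = G $$ (m - i)" for i
      by (simp add: puis_def)
    have sub: "?S \<subseteq> ?\<phi> ` ?I"
    proof
      fix a assume a: "a \<in> ?S"
      then have "a * of_nat N \<in> \<int>"
        by (auto simp: puis_def split: if_splits)
      then obtain i :: int where "a * of_nat N = of_int (-i)"
        by (metis Ints_cases minus_minus)
      then have ai: "a = ?\<phi> i"
        using assms by (simp add: field_simps)
      then have "F $$ i \<noteq> 0" "G $$ (m - i) \<noteq> 0"
        using a F[of i] G[of i] by auto
      then have "fls_subdegree F \<le> i" "fls_subdegree G \<le> m - i"
        by (auto intro: fls_subdegree_leI)
      then show "a \<in> ?\<phi> ` ?I"
        using ai by auto
    qed
    \<comment> \<open>Passing from the support to the image of a finite interval adds only zero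
      terms.\<close>
    have "kmul (puis N F) (puis N G) q = (\<Sum>a\<in>?\<phi> ` ?I. puis N F a * puis N G (q - a))"
      unfolding kmul_def by (rule sum.mono_neutral_left) (use sub in auto)
    also have "\<dots> = (\<Sum>i\<in>?I. F $$ i * G $$ (m - i))"
      by (subst sum.reindex) (auto intro: inj_on_subset[OF inj] simp only: F G o_def)
    also have "\<dots> = puis N (F * G) q"
      using m by (simp add: puis_def fls_times_nth(2))
    finally show ?thesis .
  qed
qed

lemma kzero_puis: "kzero = puis N 0"
  by (auto simp: kzero_def puis_def)

lemma kone_puis: "N > 0 \<Longrightarrow> kone = puis N 1"
  by (auto simp: kone_def puis_def fun_eq_iff elim!: Ints_cases)

section \<open>The field structure on Puiseux series\<close>

typedef pser = "{f. puiseux f}"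
  morphisms coef Abs_pser
  using puiseux_puis[of 1 0] by auto

setup_lifting type_definition_pser

lemma coef_eqI: "coef f = coef g \<Longrightarrow> f = g"
  by (simp add: coef_inject)

lemma puiseux_coef [simp]: "puiseux (coef f)"
  using coef by auto

lemma pser_common:
  obtains N F G H where "N > 0" "coef f = puis N F" "coef g = puis N G" "coef h = puis N H"
  using that by (rule puiseux_common[OF puiseux_coef puiseux_coef puiseux_coef])

instantiation pser :: comm_ring_1
begin

lift_definition zero_pser :: pser is kzero
  by (metis kzero_puis puiseux_puis zero_less_one)

lift_definition one_pser :: pser is kone
  by (metis kone_puis puiseux_puis zero_less_one)

lift_definition plus_pser :: "pser \<Rightarrow> pser \<Rightarrow> pser" is kadd
  by (metis puiseux_common kadd_puis puiseux_puis)

lift_definition uminus_pser :: "pser \<Rightarrow> pser" is kneg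
  by (metis puiseux_common kneg_puis puiseux_puis)

lift_definition times_pser :: "pser \<Rightarrow> pser \<Rightarrow> pser" is kmul
  by (metis puiseux_common kmul_puis puiseux_puis)

definition minus_pser :: "pser \<Rightarrow> pser \<Rightarrow> pser" where "minus_pser f g = f + - g"

lemmas coef_simps = zero_pser.rep_eq one_pser.rep_eq plus_pser.rep_eq uminus_pser.rep_eq
  times_pser.rep_eq

instance
proof
  \<comment> \<open>Over a common denominator every ring law is a law of Laurent series, transported
    by \<open>puis\<close>.\<close>
  fix f g h :: pser
  obtain N F G H where N: "N > 0" "coef f = puis N F" "coef g = puis N G" "coef h = puis N H"
    by (rule pser_common)
  note s = coef_simps N kadd_puis kneg_puis kmul_puis[OF N(1)] kzero_puis[of N] kone_puis[OF N(1)]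
  show "f * g * h = f * (g * h)" "f * g = g * f" "1 * f = f" "f + g + h = f + (g + h)"
    "f + g = g + f" "0 + f = f" "- f + f = 0" "(f + g) * h = f * h + g * h"
    by (rule coef_eqI; simp add: s algebra_simps)+
  show "f - g = f + - g"
    by (rule minus_pser_def)
  show "(0::pser) \<noteq> 1"
  proof
    assume "(0::pser) = 1"
    then have "coef 0 0 = coef 1 0" by simp
    then show False by (simp add: coef_simps kzero_def kone_def)
  qed
qed

end

lemma ex_pser_inverse:
  assumes "f \<noteq> (0::pser)"
  shows "\<exists>g. g * f = 1"
proof -
  obtain N F where N: "N > 0" "coef f = puis N F"
    by (rule pser_common)
  have "F \<noteq> 0"
    using assms N by (metis coef_eqI kzero_puis zero_pser.rep_eq)
  define g where "g = Abs_pser (puis N (inverse F))"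
  have "coef g = puis N (inverse F)"
    unfolding g_def using puiseux_puis[OF N(1)] by (simp add: Abs_pser_inverse)
  then have "g * f = 1"
    using \<open>F \<noteq> 0\<close> by (intro coef_eqI) (simp add: coef_simps N kmul_puis kone_puis[OF N(1)])
  then show ?thesis ..
qed

instantiation pser :: field
begin

definition inverse_pser :: "pser \<Rightarrow> pser" where
  "inverse_pser f = (if f = 0 then 0 else (SOME g. g * f = 1))"

definition divide_pser :: "pser \<Rightarrow> pser \<Rightarrow> pser" where
  "divide_pser f g = f * inverse g"

instance
  by standard
    (use someI_ex[OF ex_pser_inverse] in \<open>auto simp: inverse_pser_def divide_pser_def\<close>)

end

section \<open>Leading terms of Puiseux series\<close>

text \<open>\<open>lt f w a\<close> says $f = a t^w + {}$(lower terms), where $a = 0$ is allowed.\<close>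

definition lt :: "pser \<Rightarrow> rat \<Rightarrow> complex \<Rightarrow> bool" where
  "lt f w a \<longleftrightarrow> coef f w = a \<and> (\<forall>q>w. coef f q = 0)"

lemma coef_add: "coef (f + g) q = coef f q + coef g q"
  by (simp add: plus_pser.rep_eq kadd_def)

lemma coef_minus: "coef (- f) q = - coef f q"
  by (simp add: uminus_pser.rep_eq kneg_def)

lemma coef_0 [simp]: "coef 0 q = 0"
  by (simp add: zero_pser.rep_eq kzero_def)

lemma coef_1: "coef 1 q = (if q = 0 then 1 else 0)"
  by (simp add: one_pser.rep_eq kone_def)

lemma lt_0: "lt 0 w 0"
  by (simp add: lt_def)

lemma lt_1: "lt 1 0 1"
  by (simp add: lt_def coef_1)

lemma lt_add: "lt f w a \<Longrightarrow> lt g w b \<Longrightarrow> lt (f + g) w (a + b)"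
  by (simp add: lt_def coef_add)

lemma lt_uminus: "lt f w a \<Longrightarrow> lt (- f) w (- a)"
  by (simp add: lt_def coef_minus)

lemma lt_diff: "lt f w a \<Longrightarrow> lt g w b \<Longrightarrow> lt (f - g) w (a - b)"
  using lt_add[OF _ lt_uminus] by fastforce

text \<open>Exponents in the supports are at most \<open>w\<close> and \<open>v\<close>, so no pair
  sums to more than \<open>w + v\<close>, and only the pair \<open>(w, v)\<close> reaches it. Zero
  leading coefficients are allowed, so no case distinction on cancellation arises later.\<close>

lemma lt_mult:
  assumes "lt f w a" "lt g v b"
  shows "lt (f * g) (w + v) (a * b)"
proof -
  have "coef (f * g) q = 0" if "q > w + v" for q
  proof -
    have "{x. coef f x \<noteq> 0 \<and> coef g (q - x) \<noteq> 0} = {}"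
    proof (rule ccontr)
      assume "{x. coef f x \<noteq> 0 \<and> coef g (q - x) \<noteq> 0} \<noteq> {}"
      then obtain x where "\<not> x > w" "\<not> q - x > v"
        using assms unfolding lt_def by blast
      then show False using that by linarith
    qed
    then show ?thesis unfolding times_pser.rep_eq kmul_def by (simp only: sum.empty)
  qed
  moreover have "coef (f * g) (w + v) = a * b"
  proof -
    let ?S = "{x. coef f x \<noteq> 0 \<and> coef g (w + v - x) \<noteq> 0}"
    have "?S \<subseteq> {w}"
    proof
      fix x assume "x \<in> ?S"
      then have "\<not> x > w" "\<not> w + v - x > v"
        using assms unfolding lt_def by blast+
      then show "x \<in> {w}" by simp
    qed
    then have "coef (f * g) (w + v) = (\<Sum>x\<in>{w}. coef f x * coef g (w + v - x))"
      unfolding times_pser.rep_eq kmul_def by (intro sum.mono_neutral_left) auto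
    then show ?thesis using assms by (simp add: lt_def)
  qed
  ultimately show ?thesis by (simp add: lt_def)
qed

lemma lt_weaken: "lt f w a \<Longrightarrow> w < v \<Longrightarrow> lt f v 0"
  by (auto simp: lt_def)

lemma lt_unique: "lt f w a \<Longrightarrow> lt f v b \<Longrightarrow> a \<noteq> 0 \<Longrightarrow> b \<noteq> 0 \<Longrightarrow> w = v \<and> a = b"
  unfolding lt_def by (metis linorder_neqE)

lemma lt_nonzero: "lt f w a \<Longrightarrow> a \<noteq> 0 \<Longrightarrow> f \<noteq> 0"
  by (auto simp: lt_def)

definition tpow :: "complex \<Rightarrow> rat \<Rightarrow> pser" where
  "tpow a w = Abs_pser (\<lambda>q. if q = w then a else 0)"

lemma coef_tpow: "coef (tpow a w) q = (if q = w then a else 0)"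
proof -
  have "\<exists>N. N > 0 \<and> w * of_nat N \<in> \<int>"
  proof (cases w)
    case (Fract a b)
    then have "w * of_nat (nat b) = of_int a"
      by (simp add: Fract_of_int_quotient)
    then show ?thesis
      using Fract by (metis Ints_of_int zero_less_nat_eq)
  qed
  then have "puiseux (\<lambda>q. if q = w then a else 0)"
    unfolding puiseux_def by (auto intro!: bdd_aboveI[of _ w] split: if_splits)
  then show ?thesis
    by (simp add: tpow_def Abs_pser_inverse)
qed

lemma lt_tpow: "lt (tpow a w) w a"
  by (simp add: lt_def coef_tpow)

text \<open>\<open>puis\<close> reverses the order of exponents, so the subdegree of the Laurent
  series marks the largest exponent.\<close>

lemma ex_lt:
  assumes "f \<noteq> 0"
  obtains w a where "lt f w a" "a \<noteq> 0"
proof -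
  obtain N F where N: "N > 0" "coef f = puis N F"
    by (rule pser_common)
  have F: "F \<noteq> 0"
    using assms N by (metis coef_eqI kzero_puis zero_pser.rep_eq)
  define w :: rat where "w = - of_int (fls_subdegree F) / of_nat N"
  have "coef f w = F $$ fls_subdegree F"
    using N by (simp add: puis_def w_def)
  moreover have "coef f q = 0" if "q > w" for q
  proof (cases "q * of_nat N \<in> \<int>")
    case True
    then obtain m :: int where m: "q * of_nat N = of_int m"
      by (auto elim: Ints_cases)
    have "- of_int (fls_subdegree F) < q * of_nat N"
      using that N(1) by (simp add: w_def field_simps)
    then have "- m < fls_subdegree F"
      using m by linarith
    then show ?thesis using m N by (simp add: puis_def)
  qed (use N in \<open>simp add: puis_def\<close>)
  ultimately show ?thesis
    using that[of w "F $$ fls_subdegree F"] F by (simp add: lt_def)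
qed

lemma lt_inverse:
  assumes "lt f w a" "a \<noteq> 0"
  shows "lt (inverse f) (- w) (inverse a)"
proof -
  have f: "f \<noteq> 0" using assms lt_nonzero by blast
  obtain v b where v: "lt (inverse f) v b" "b \<noteq> 0"
    using ex_lt f by (metis inverse_nonzero_iff_nonzero)
  have "lt 1 (w + v) (a * b)"
    using lt_mult[OF assms(1) v(1)] f by simp
  then have "w + v = 0 \<and> a * b = 1"
    using lt_unique[OF _ lt_1] assms(2) v(2) by fastforce
  then have "v = - w" "b = inverse a"
    using assms(2) by (auto simp: field_simps)
  then show ?thesis using v by simp
qed

lemma lt_divide: "lt f w a \<Longrightarrow> lt g v b \<Longrightarrow> b \<noteq> 0 \<Longrightarrow> lt (f / g) (w - v) (a / b)"
  using lt_mult[OF _ lt_inverse, of f w a g v b] by (simp add: divide_inverse)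

text \<open>Dividing by the square of a monomial root of the leading term leaves a series
  \<open>1 + ...\<close> without positive exponents. As a formal power series with constant term 1
  it has a square root.\<close>

lemma ex_pser_sqrt: "\<exists>g::pser. g * g = f"
proof (cases "f = 0")
  case False
  then obtain w a where wa: "lt f w a" "a \<noteq> 0" by (rule ex_lt)
  define T where "T = tpow (csqrt a) (w / 2)"
  define h where "h = f / (T * T)"
  have T: "T \<noteq> 0" unfolding T_def using lt_nonzero[OF lt_tpow] wa(2) by simp
  have "csqrt a * csqrt a = a"
    by (metis power2_csqrt power2_eq_square)
  then have "lt (T * T) w a"
    using lt_mult[OF lt_tpow lt_tpow, of "csqrt a" "w / 2" "csqrt a" "w / 2"] by (simp add: T_def)
  then have h: "lt h 0 1"
    using lt_divide[OF wa(1) _ wa(2)] wa(2) by (fastforce simp: h_def)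
  obtain N F where N: "N > 0" "coef h = puis N F"
    by (rule pser_common)
  have Fn: "F $$ n = coef h (- of_int n / of_nat N)" for n
    using N by (simp add: puis_def)
  \<comment> \<open>Negative indices of \<open>F\<close> are positive exponents of \<open>h\<close>,
    and there are none.\<close>
  have "fls_subdegree F \<ge> 0"
  proof (rule fls_subdegree_geI)
    show "F \<noteq> 0" using h Fn[of 0] by (auto simp: lt_def)
    show "F $$ k = 0" if "k < 0" for k
    proof -
      have "- of_int k / of_nat N > (0::rat)" using that N(1) by (intro divide_pos_pos) auto
      then show ?thesis unfolding Fn using h by (auto simp: lt_def)
    qed
  qed
  define G where "G = fls_regpart F"
  have FG: "fps_to_fls G = F"
    unfolding G_def using \<open>fls_subdegree F \<ge> 0\<close> by simp
  have "F $$ 0 = 1" using h Fn[of 0] by (simp add: lt_def)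
  then have G0: "G $ 0 = 1" by (simp add: G_def)
  \<comment> \<open>The function argument selects the root of the constant coefficient; the constant
    1 is correct because \<open>G $ 0 = 1\<close>.\<close>
  define R where "R = fps_radical (\<lambda>_ _. 1) (Suc 1) G"
  have "R ^ Suc 1 = G"
    unfolding R_def using power_radical[of G "\<lambda>_ _. 1" 1] G0 by simp
  then have R: "R * R = G" by (simp add: power2_eq_square)
  define k where "k = Abs_pser (puis N (fps_to_fls R))"
  have k: "coef k = puis N (fps_to_fls R)"
    unfolding k_def using puiseux_puis[OF N(1)] by (simp add: Abs_pser_inverse)
  have kk: "k * k = h"
    by (rule coef_eqI) (simp add: coef_simps k kmul_puis N R FG flip: fls_times_fps_to_fls)
  have "(k * T) * (k * T) = h * (T * T)"
    using kk by (metis mult.assoc mult.left_commute)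
  also have "\<dots> = f" using T by (simp add: h_def)
  finally show ?thesis ..
qed auto

section \<open>Matrices and lines over the Puiseux field\<close>

type_synonym pmat = "pser \<times> pser \<times> pser \<times> pser"

fun emb :: "pmat \<Rightarrow> kmat" where
  "emb (a,b,c,d) = (coef a, coef b, coef c, coef d)"

fun pdet :: "pmat \<Rightarrow> pser" where
  "pdet (a,b,c,d) = a*d - b*c"

fun pscale :: "pser \<Rightarrow> pmat \<Rightarrow> pmat" where
  "pscale s (a,b,c,d) = (s*a, s*b, s*c, s*d)"

fun ppol :: "pmat \<Rightarrow> pmat \<Rightarrow> pser" where
  "ppol (a,b,c,d) (a',b',c',d') = a*d' + d*a' - b*c' - c*b'"

fun mlt :: "pmat \<Rightarrow> rat \<Rightarrow> cmat \<Rightarrow> bool" where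
  "mlt (a,b,c,d) w (a',b',c',d') \<longleftrightarrow> lt a w a' \<and> lt b w b' \<and> lt c w c' \<and> lt d w d'"

definition pclass :: "pmat \<Rightarrow> kmat set" where
  "pclass X = kclass (emb X)"

lemma coef_eq_iff: "coef f = coef g \<longleftrightarrow> f = g"
  by (simp add: coef_inject)

lemma emb_eq_iff: "emb X = emb Y \<longleftrightarrow> X = Y"
  by (cases X; cases Y) (auto simp: coef_eq_iff)

lemma kmat_ok_emb: "kmat_ok (emb X)"
  by (cases X) auto

lemma ex_coef: "puiseux f \<Longrightarrow> \<exists>g. f = coef g"
  using Abs_pser_inverse[of f] by (metis mem_Collect_eq)

text \<open>The placement of \<open>P\<close> and \<open>Q\<close> around \<open>puiseux f\<close>
  copies the shape of the set comprehension in \<open>kclass\<close>, so that the equivalence can be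
  used as a rewrite rule there.\<close>

lemma ex_puiseux: "(\<exists>f. P f \<and> puiseux f \<and> Q f) \<longleftrightarrow> (\<exists>f. P (coef f) \<and> Q (coef f))"
  using ex_coef puiseux_coef by blast

lemma ex_puiseux2:
  "(\<exists>f g. P f g \<and> puiseux f \<and> puiseux g \<and> Q f g) \<longleftrightarrow>
   (\<exists>f g. P (coef f) (coef g) \<and> Q (coef f) (coef g))"
proof
  assume "\<exists>f g. P f g \<and> puiseux f \<and> puiseux g \<and> Q f g"
  then obtain f g where fg: "P f g" "puiseux f" "puiseux g" "Q f g" by blast
  obtain f' where "f = coef f'" using ex_coef[OF fg(2)] ..
  moreover obtain g' where "g = coef g'" using ex_coef[OF fg(3)] ..
  ultimately show "\<exists>f g. P (coef f) (coef g) \<and> Q (coef f) (coef g)" using fg by blast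
next
  assume "\<exists>f g. P (coef f) (coef g) \<and> Q (coef f) (coef g)"
  then show "\<exists>f g. P f g \<and> puiseux f \<and> puiseux g \<and> Q f g"
    using puiseux_coef by blast
qed

lemma kmat_ok_ex_emb: "kmat_ok M \<Longrightarrow> \<exists>X. M = emb X"
proof -
  assume M: "kmat_ok M"
  obtain a b c d where "M = (a,b,c,d)" by (cases M)
  moreover from this M have p: "puiseux a" "puiseux b" "puiseux c" "puiseux d" by simp_all
  moreover obtain a' where "a = coef a'" using ex_coef[OF p(1)] ..
  moreover obtain b' where "b = coef b'" using ex_coef[OF p(2)] ..
  moreover obtain c' where "c = coef c'" using ex_coef[OF p(3)] ..
  moreover obtain d' where "d = coef d'" using ex_coef[OF p(4)] ..
  ultimately have "M = emb (a',b',c',d')" by simp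
  then show ?thesis ..
qed

lemma kdet_emb: "kdet (emb X) = coef (pdet X)"
  by (cases X) (simp only: emb.simps kdet.simps pdet.simps minus_pser_def coef_simps)

lemma kscale_emb: "kscale (coef s) (emb X) = emb (pscale s X)"
  by (cases X) (simp add: coef_simps)

lemma kmadd_emb: "kmadd (emb X) (emb Y) = emb (X + Y)"
  by (cases X; cases Y) (simp add: coef_simps)

lemma kmzero_emb: "kmzero = emb 0"
  by (simp add: kmzero_def coef_simps zero_prod_def)

lemma coef_eq_kzero_iff: "coef f = kzero \<longleftrightarrow> f = 0"
  by (metis coef_eq_iff zero_pser.rep_eq)

lemma pscale_simps:
  "pscale s (X + Y) = pscale s X + pscale s Y"
  "pscale (s + s') X = pscale s X + pscale s' X"
  "pscale s (pscale s' X) = pscale (s * s') X"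
  "pscale 1 X = X" "pscale 0 X = 0" "pscale s 0 = 0"
  "pscale (- s) X = - pscale s X"
  by (cases X; cases Y; auto simp: algebra_simps zero_prod_def)+

lemma pscale_comb:
  "pscale x (pscale a A + pscale b B) + pscale y (pscale c A + pscale d B)
    = pscale (x * a + y * c) A + pscale (x * b + y * d) B"
  by (cases A; cases B) (auto simp: algebra_simps)

lemma pscale_eq_0_iff: "pscale s X = 0 \<longleftrightarrow> s = 0 \<or> X = 0"
  by (cases X) (auto simp: zero_prod_def)

lemma pdet_pscale: "pdet (pscale s X) = s * s * pdet X"
  by (cases X) (auto simp: algebra_simps)

lemma pdet_comb:
  "pdet (pscale x A + pscale y B) = x * x * pdet A + x * y * ppol A B + y * y * pdet B"
  by (cases A; cases B) (auto simp: algebra_simps)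

lemma pclass_eq: "pclass X = {emb (pscale s X) | s. s \<noteq> 0}"
  unfolding pclass_def kclass_def by (simp add: ex_puiseux kscale_emb coef_eq_kzero_iff)

lemma pclass_eq_iff: "pclass X = pclass Y \<longleftrightarrow> (\<exists>s. s \<noteq> 0 \<and> Y = pscale s X)"
proof
  assume "pclass X = pclass Y"
  moreover have "emb Y \<in> pclass Y"
    unfolding pclass_eq by (auto intro!: exI[of _ 1] simp: pscale_simps)
  ultimately have "emb Y \<in> pclass X" by simp
  then show "\<exists>s. s \<noteq> 0 \<and> Y = pscale s X"
    unfolding pclass_eq by (auto simp: emb_eq_iff)
next
  assume "\<exists>s. s \<noteq> 0 \<and> Y = pscale s X"
  then obtain s where s: "s \<noteq> 0" "Y = pscale s X" by blast
  show "pclass X = pclass Y"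
    unfolding pclass_eq
  proof (intro subset_antisym subsetI; clarsimp)
    fix u assume "u \<noteq> (0::pser)"
    then show "\<exists>v. emb (pscale u X) = emb (pscale v Y) \<and> v \<noteq> 0"
      using s by (intro exI[of _ "u / s"]) (auto simp: pscale_simps)
  next
    fix u assume "u \<noteq> (0::pser)"
    then show "\<exists>v. emb (pscale u Y) = emb (pscale v X) \<and> v \<noteq> 0"
      using s by (intro exI[of _ "u * s"]) (auto simp: pscale_simps)
  qed
qed

lemma pclass_pscale: "s \<noteq> 0 \<Longrightarrow> pclass (pscale s X) = pclass X"
  by (subst eq_commute) (auto simp: pclass_eq_iff)

lemma pclass_in_QK_iff: "X \<noteq> 0 \<Longrightarrow> pclass X \<in> QK \<longleftrightarrow> pdet X = 0"
proof
  assume "X \<noteq> 0" "pclass X \<in> QK"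
  then obtain M where M: "pclass X = kclass M" "kmat_ok M" "M \<noteq> kmzero" "kdet M = kzero"
    unfolding QK_def by blast
  obtain Y where "M = emb Y" using kmat_ok_ex_emb[OF M(2)] ..
  with M have "pclass X = pclass Y" "Y \<noteq> 0" "pdet Y = 0"
    by (simp_all add: pclass_def kdet_emb kmzero_emb emb_eq_iff coef_eq_kzero_iff)
  then show "pdet X = 0"
    by (auto simp: pclass_eq_iff pdet_pscale)
next
  assume "X \<noteq> 0" "pdet X = 0"
  then have "kmat_ok (emb X) \<and> emb X \<noteq> kmzero \<and> kdet (emb X) = kzero"
    by (simp add: kmat_ok_emb kmzero_emb emb_eq_iff kdet_emb coef_eq_kzero_iff)
  then show "pclass X \<in> QK"
    unfolding QK_def pclass_def by blast
qed

definition indep :: "pmat \<Rightarrow> pmat \<Rightarrow> bool" where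
  "indep A B \<longleftrightarrow> (\<forall>u v. pscale u A + pscale v B = 0 \<longrightarrow> u = 0 \<and> v = 0)"

definition pline :: "pmat \<Rightarrow> pmat \<Rightarrow> kmat set set" where
  "pline A B = {pclass (pscale x A + pscale y B) | x y. (x, y) \<noteq> (0, 0)}"

lemma is_kline_pline:
  assumes "is_kline L"
  obtains A B where "indep A B" "L = pline A B"
proof -
  obtain M M' where M: "kmat_ok M" "kmat_ok M'"
    "\<forall>u v. puiseux u \<and> puiseux v \<and> kmadd (kscale u M) (kscale v M') = kmzero
              \<longrightarrow> u = kzero \<and> v = kzero"
    "L = {kclass (kmadd (kscale u M) (kscale v M')) | u v.
            puiseux u \<and> puiseux v \<and> (u, v) \<noteq> (kzero, kzero)}"
    using assms unfolding is_kline_def by blast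
  obtain A where A: "M = emb A" using kmat_ok_ex_emb[OF M(1)] ..
  obtain B where B: "M' = emb B" using kmat_ok_ex_emb[OF M(2)] ..
  note AB = A B
  have "indep A B"
    unfolding indep_def
  proof (intro allI impI)
    fix u v assume "pscale u A + pscale v B = 0"
    then show "u = 0 \<and> v = 0"
      using M(3)[rule_format, of "coef u" "coef v"]
      by (simp add: AB kscale_emb kmadd_emb kmzero_emb emb_eq_iff coef_eq_kzero_iff)
  qed
  moreover have "L = pline A B"
    unfolding M(4) pline_def pclass_def AB ex_puiseux2 kscale_emb kmadd_emb prod.inject
      coef_eq_kzero_iff ..
  ultimately show ?thesis
    by (rule that)
qed

lemma pline_sub:
  assumes "A' = pscale a A + pscale b B" "B' = pscale c A + pscale d B" "a * d - b * c \<noteq> 0"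
  shows "pline A' B' \<subseteq> pline A B"
proof
  fix P assume "P \<in> pline A' B'"
  then obtain x y where P: "P = pclass (pscale x A' + pscale y B')" "(x, y) \<noteq> (0, 0)"
    unfolding pline_def by blast
  have *: "pscale x A' + pscale y B' = pscale (x * a + y * c) A + pscale (x * b + y * d) B"
    unfolding assms(1,2) pscale_comb ..
  have "(x * a + y * c, x * b + y * d) \<noteq> (0, 0)"
  proof
    assume "(x * a + y * c, x * b + y * d) = (0, 0)"
    then have e: "x * a + y * c = 0" "x * b + y * d = 0" by auto
    \<comment> \<open>This multiplies the coefficient vector by the adjugate of the base change
      matrix.\<close>
    have "x * (a * d - b * c) = d * (x * a + y * c) - c * (x * b + y * d)"
      "y * (a * d - b * c) = a * (x * b + y * d) - b * (x * a + y * c)"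
      by (simp_all add: algebra_simps)
    then have "x = 0" "y = 0"
      using assms(3) unfolding e by simp_all
    then show False using P by simp
  qed
  then show "P \<in> pline A B"
    unfolding pline_def P(1) * by blast
qed

lemma pline_change_basis:
  assumes "A' = pscale a A + pscale b B" "B' = pscale c A + pscale d B" "a * d - b * c \<noteq> 0"
  shows "pline A' B' = pline A B"
proof (rule subset_antisym)
  show "pline A' B' \<subseteq> pline A B"
    using assms by (rule pline_sub)
  let ?\<delta> = "a * d - b * c"
  \<comment> \<open>The fractions are the entries of the inverse matrix, so the reverse inclusion is
    again an instance of \<open>pline_sub\<close>.\<close>
  have "d / ?\<delta> * a + - b / ?\<delta> * c = 1" "d / ?\<delta> * b + - b / ?\<delta> * d = 0"
    "- c / ?\<delta> * a + a / ?\<delta> * c = 0" "- c / ?\<delta> * b + a / ?\<delta> * d = 1"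
    using assms(3) by (simp_all add: mult.commute flip: add_divide_distrib diff_divide_distrib)
  then have e: "A = pscale (d / ?\<delta>) A' + pscale (- b / ?\<delta>) B'"
    "B = pscale (- c / ?\<delta>) A' + pscale (a / ?\<delta>) B'"
    unfolding assms(1,2) pscale_comb by (simp_all only: pscale_simps add_0 add_0_right)
  have "d / ?\<delta> * (a / ?\<delta>) - - b / ?\<delta> * (- c / ?\<delta>) = ?\<delta> / (?\<delta> * ?\<delta>)"
    by (simp add: diff_divide_distrib mult.commute)
  also have "\<dots> \<noteq> 0" using assms(3) by simp
  finally show "pline A B \<subseteq> pline A' B'"
    using e by (intro pline_sub)
qed

lemma indep_nonzero: "indep A B \<Longrightarrow> (x, y) \<noteq> (0, 0) \<Longrightarrow> pscale x A + pscale y B \<noteq> 0"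
  unfolding indep_def by blast

text \<open>Representatives of the two intersection points span the plane because the points differ.
  Their polar product is nonzero, since otherwise the whole line would lie in the quadric and would
  meet it in more than two points.\<close>

lemma two_isotropic_generators:
  assumes "is_kline L" "card (L \<inter> QK) = 2"
  obtains A B where "indep A B" "L = pline A B" "pdet A = 0" "pdet B = 0" "ppol A B \<noteq> 0"
proof -
  obtain A' B' where AB': "indep A' B'" "L = pline A' B'"
    using is_kline_pline[OF assms(1)] .
  obtain P Q where PQ: "L \<inter> QK = {P, Q}" "P \<noteq> Q"
    using assms(2) by (auto simp: card_2_iff)
  obtain a b where P: "P = pclass (pscale a A' + pscale b B')" "(a, b) \<noteq> (0, 0)"
    using PQ(1) unfolding AB'(2) pline_def by blast
  obtain c d where Q: "Q = pclass (pscale c A' + pscale d B')" "(c, d) \<noteq> (0, 0)"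
    using PQ(1) unfolding AB'(2) pline_def by blast
  define A where "A = pscale a A' + pscale b B'"
  define B where "B = pscale c A' + pscale d B'"
  have nz: "A \<noteq> 0" "B \<noteq> 0"
    using indep_nonzero[OF AB'(1)] P Q by (auto simp: A_def B_def)
  have "P \<in> QK" "Q \<in> QK" using PQ(1) by blast+
  then have det: "pdet A = 0" "pdet B = 0"
    using pclass_in_QK_iff[OF nz(1)] pclass_in_QK_iff[OF nz(2)]
    unfolding P(1) Q(1) A_def[symmetric] B_def[symmetric] by blast+
  have ind: "indep A B"
    unfolding indep_def
  proof (intro allI impI, rule ccontr)
    fix u v assume uv: "pscale u A + pscale v B = 0" "\<not> (u = 0 \<and> v = 0)"
    then have "u \<noteq> 0" "v \<noteq> 0"
      using nz by (auto simp: pscale_eq_0_iff pscale_simps)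
    have "pscale (1 / v) (pscale u A + pscale v B) = 0"
      using uv by (simp add: pscale_simps)
    then have "B = pscale (- (u / v)) A"
      using \<open>v \<noteq> 0\<close> by (simp add: pscale_simps eq_neg_iff_add_eq_0 add.commute)
    then have "pclass A = pclass B"
      using \<open>u \<noteq> 0\<close> \<open>v \<noteq> 0\<close> by (subst pclass_eq_iff) (metis divide_eq_0_iff neg_equal_0_iff_equal)
    then show False using P Q PQ by (simp add: A_def B_def)
  qed
  have "a * d - b * c \<noteq> 0"
  proof
    assume 0: "a * d - b * c = 0"
    \<comment> \<open>The adjugate of the coefficient matrix recovers multiples of \<open>A'\<close>
      and \<open>B'\<close>; a vanishing determinant would give a dependence between
      \<open>A\<close> and \<open>B\<close>.\<close>
    have "pscale d A + pscale (- b) B = pscale (a * d - b * c) A'"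
      "pscale (- c) A + pscale a B = pscale (a * d - b * c) B'"
      by (cases A'; cases B'; simp add: A_def B_def algebra_simps)+
    then have "pscale d A + pscale (- b) B = 0" "pscale (- c) A + pscale a B = 0"
      unfolding 0 by (simp_all add: pscale_simps)
    then show False
      using ind P(2) unfolding indep_def by fastforce
  qed
  then have L: "L = pline A B"
    using pline_change_basis[OF A_def B_def] AB' by simp
  have "ppol A B \<noteq> 0"
  proof
    assume 0: "ppol A B = 0"
    \<comment> \<open>With vanishing polar product \<open>A + B\<close> is isotropic, hence a
      representative of \<open>P\<close> or \<open>Q\<close>, which contradicts
      independence.\<close>
    have X: "pscale 1 A + pscale 1 B \<noteq> 0"
      using indep_nonzero[OF ind, of 1 1] by simp
    moreover have "pdet (pscale 1 A + pscale 1 B) = 0"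
      unfolding pdet_comb by (simp add: det 0)
    moreover have "pclass (pscale 1 A + pscale 1 B) \<in> L"
      unfolding L pline_def by (intro CollectI exI[of _ 1]) simp
    ultimately have "pclass (pscale 1 A + pscale 1 B) \<in> {P, Q}"
      using PQ(1) pclass_in_QK_iff by blast
    then have "pclass A = pclass (pscale 1 A + pscale 1 B) \<or>
        pclass B = pclass (pscale 1 A + pscale 1 B)"
      using P(1) Q(1) unfolding A_def[symmetric] B_def[symmetric] by auto
    then consider s where "pscale 1 A + pscale 1 B = pscale s A"
      | s where "pscale 1 A + pscale 1 B = pscale s B"
      unfolding pclass_eq_iff by blast
    then show False
    proof cases
      case (1 s)
      have "pscale (1 - s) A + pscale 1 B = (pscale 1 A + pscale 1 B) - pscale s A"
        by (cases A; cases B) (simp add: algebra_simps)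
      then show False
        using ind unfolding 1 indep_def by (metis diff_self zero_neq_one)
    next
      case (2 s)
      have "pscale 1 A + pscale (1 - s) B = (pscale 1 A + pscale 1 B) - pscale s B"
        by (cases A; cases B) (simp add: algebra_simps)
      then show False
        using ind unfolding 2 indep_def by (metis diff_self zero_neq_one)
    qed
  qed
  then show ?thesis
    using that ind L det by blast
qed

section \<open>Leading terms of matrices\<close>

lemma mlt_add: "mlt X w A \<Longrightarrow> mlt Y w B \<Longrightarrow> mlt (X + Y) w (A + B)"
  by (cases X; cases A; cases Y; cases B) (simp add: lt_add)

lemma mlt_pscale: "lt s v a \<Longrightarrow> mlt X w A \<Longrightarrow> mlt (pscale s X) (v + w) (cscale a A)"
  by (cases X; cases A) (simp add: lt_mult)

lemma mlt_pdet: "mlt X w A \<Longrightarrow> lt (pdet X) (w + w) (cdet A)"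
  by (cases X; cases A) (simp only: mlt.simps pdet.simps cdet.simps lt_diff lt_mult)

lemma mlt_ppol:
  assumes "mlt X w A" "mlt Y v B"
  shows "lt (ppol X Y) (w + v) (cpol A B)"
  using assms by (cases X; cases A; cases Y; cases B) (auto intro!: lt_diff lt_add lt_mult)

text \<open>One exponent that dominates the whole list and is attained by some member. It serves for
  the entries of a matrix, for the coordinates of a point and for the coefficients of the quadratic
  form.\<close>

lemma list_leading:
  "(\<forall>f\<in>set l. f = 0) \<or> (\<exists>w. (\<forall>f\<in>set l. \<exists>a. lt f w a) \<and> (\<exists>f\<in>set l. coef f w \<noteq> 0))"
proof (induction l)
  case (Cons f l)
  show ?case
  proof (cases "f = 0")
    case True
    then show ?thesis using Cons lt_0 by auto
  next
    case False
    then obtain w a where w: "lt f w a" "a \<noteq> 0" by (rule ex_lt)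
    from Cons show ?thesis
    proof
      assume "\<forall>f\<in>set l. f = 0"
      then show ?thesis
        using w lt_0 by (auto simp: lt_def intro!: exI[of _ w])
    next
      assume "\<exists>v. (\<forall>f\<in>set l. \<exists>a. lt f v a) \<and> (\<exists>f\<in>set l. coef f v \<noteq> 0)"
      then obtain v where v: "\<forall>f\<in>set l. \<exists>a. lt f v a" "\<exists>f\<in>set l. coef f v \<noteq> 0" by blast
      show ?thesis
      proof (cases "v < w")
        case True
        have "\<exists>a. lt g w a" if "g \<in> set (f # l)" for g
        proof (cases "g = f")
          case False
          then show ?thesis using v(1) that lt_weaken[OF _ True] by fastforce
        qed (use w in blast)
        moreover have "coef f w \<noteq> 0" using w by (simp add: lt_def)
        ultimately show ?thesis by auto
      next
        case False
        then have "\<exists>a. lt f v a"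
          using w lt_weaken by (metis linorder_neqE)
        then show ?thesis
          using v by (intro disjI2 exI[of _ v]) auto
      qed
    qed
  qed
qed simp

lemma ex_mlt:
  assumes "X \<noteq> 0"
  obtains w A where "mlt X w A" "A \<noteq> 0"
proof -
  obtain a b c d where X: "X = (a,b,c,d)" by (cases X)
  from list_leading[of "[a,b,c,d]"] assms X
  obtain w where w: "\<forall>f\<in>set [a,b,c,d]. \<exists>e. lt f w e" "\<exists>f\<in>set [a,b,c,d]. coef f w \<noteq> 0"
    by (auto simp: zero_prod_def)
  have "mlt X w (coef a w, coef b w, coef c w, coef d w)"
    using w(1) by (auto simp: X lt_def)
  moreover have "(coef a w, coef b w, coef c w, coef d w) \<noteq> 0"
    using w(2) by (auto simp: zero_prod_def)
  ultimately show ?thesis using that by blast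
qed

lemma lead_emb:
  assumes "mlt X w A" "A \<noteq> 0"
  shows "lead_exp (emb X) = w" "lead_coef (emb X) = A"
proof -
  obtain a b c d where X: "X = (a,b,c,d)" by (cases X)
  obtain a' b' c' d' where A: "A = (a',b',c',d')" by (cases A)
  have l: "lt a w a'" "lt b w b'" "lt c w c'" "lt d w d'" using assms by (auto simp: X A)
  have e: "\<exists>e\<in>set (kents (emb X)). e w \<noteq> 0"
    using assms(2) l by (auto simp: X A lt_def zero_prod_def)
  have "\<forall>q. (\<exists>e\<in>set (kents (emb X)). e q \<noteq> 0) \<longrightarrow> q \<le> w"
    using l by (auto simp: X lt_def not_less[symmetric])
  then show *: "lead_exp (emb X) = w"
    unfolding lead_exp_def using e by (intro Greatest_equality) auto
  show "lead_coef (emb X) = A"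
    unfolding lead_coef_def * using l by (auto simp: X A lt_def)
qed

section \<open>The valuation of a point\<close>

text \<open>The formula common to \<open>cone\<close>, to the nonsingular case of
  \<open>VALm\<close> and, at level 0, to \<open>kappa\<close>.\<close>

definition conept :: "real \<Rightarrow> cmat \<Rightarrow> cmat set" where
  "conept \<alpha> B = cclass (exp \<alpha> *\<^sub>R B + exp (-\<alpha>) *\<^sub>R cctr (cadj B))"

lemma cscale_simps:
  "cscale s (X + Y) = cscale s X + cscale s Y"
  "cscale (s + s') X = cscale s X + cscale s' X"
  "cscale s (cscale s' X) = cscale (s * s') X"
  "cscale 1 X = X" "cscale 0 X = 0" "cscale s 0 = 0"
  "cscale (- s) X = - cscale s X"
  by (cases X; cases Y; auto simp: algebra_simps zero_prod_def)+

lemma cscale_eq_0_iff: "cscale s X = 0 \<longleftrightarrow> s = 0 \<or> X = 0"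
  by (cases X) (auto simp: zero_prod_def)

lemma cdet_cscale: "cdet (cscale s X) = s * s * cdet X"
  by (cases X) (auto simp: algebra_simps)

lemma cdet_comb:
  "cdet (cscale x A + cscale y B) = x * x * cdet A + x * y * cpol A B + y * y * cdet B"
  by (cases A; cases B) (auto simp: algebra_simps)

lemma cclass_eq_iff: "cclass X = cclass Y \<longleftrightarrow> (\<exists>s. s \<noteq> 0 \<and> Y = cscale s X)"
proof
  assume "cclass X = cclass Y"
  moreover have "Y \<in> cclass Y"
    unfolding cclass_def by (auto intro!: exI[of _ 1] simp: cscale_simps)
  ultimately show "\<exists>s. s \<noteq> 0 \<and> Y = cscale s X"
    by (auto simp: cclass_def)
next
  assume "\<exists>s. s \<noteq> 0 \<and> Y = cscale s X"
  then obtain s where s: "s \<noteq> 0" "Y = cscale s X" by blast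
  show "cclass X = cclass Y"
    unfolding cclass_def
  proof (intro subset_antisym subsetI; clarsimp)
    fix u assume "u \<noteq> (0::complex)"
    then show "\<exists>v. cscale u X = cscale v Y \<and> v \<noteq> 0"
      using s by (intro exI[of _ "u / s"]) (auto simp: cscale_simps)
  next
    fix u assume "u \<noteq> (0::complex)"
    then show "\<exists>v. cscale u Y = cscale v X \<and> v \<noteq> 0"
      using s by (intro exI[of _ "u * s"]) (auto simp: cscale_simps)
  qed
qed

lemma cclass_cscale: "s \<noteq> 0 \<Longrightarrow> cclass (cscale s X) = cclass X"
  by (subst eq_commute) (auto simp: cclass_eq_iff)

lemma conept_uminus: "conept \<alpha> (- B) = conept \<alpha> B"
proof -
  have "exp \<alpha> *\<^sub>R (- B) + exp (-\<alpha>) *\<^sub>R cctr (cadj (- B))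
      = cscale (-1) (exp \<alpha> *\<^sub>R B + exp (-\<alpha>) *\<^sub>R cctr (cadj B))"
    by (cases B) (simp add: algebra_simps)
  then show ?thesis
    unfolding conept_def by (simp add: cclass_cscale)
qed

text \<open>Two square roots of the same number differ by a sign, which the complex class does not
  see. All arbitrary choices of a root are removed by this rule.\<close>

lemma conept_sign:
  assumes "a * a = b * (b::complex)"
  shows "conept \<alpha> (cscale a B) = conept \<alpha> (cscale b B)"
proof -
  have "a = b \<or> a = - b" using assms by (simp add: square_eq_iff)
  then show ?thesis by (auto simp: cscale_simps conept_uminus)
qed

lemma csqrt_mult_self: "csqrt z * csqrt z = z"
  by (metis power2_csqrt power2_eq_square)

lemma inverse_csqrt_square: "inverse (csqrt z) * inverse (csqrt z) = inverse z"
  by (metis csqrt_mult_self inverse_mult_distrib)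

text \<open>If \<open>u\<close> normalises the determinant to 1 and has leading term
  \<open>\<sigma>\<close> at exponent \<open>v\<close>, then \<open>2 * v + \<omega> = 0\<close> and
  \<open>\<sigma> * \<sigma> * W = 1\<close>. This determines the level, and the phase up to sign,
  whichever representative \<open>SOME\<close> selects.\<close>

lemma VALm_emb_nonsingular:
  assumes X: "mlt X \<mu> B" "B \<noteq> 0" and det: "lt (pdet X) \<omega> W" "W \<noteq> 0"
  shows "VALm (emb X) = conept (of_rat (\<mu> - \<omega> / 2)) (cscale (inverse (csqrt W)) B)"
proof -
  have dX: "pdet X \<noteq> 0" using lt_nonzero det by blast
  let ?P = "\<lambda>A'. \<exists>s. puiseux s \<and> s \<noteq> kzero \<and> A' = kscale s (emb X) \<and> kdet A' = kone"
  obtain s where s: "s * s = inverse (pdet X)" using ex_pser_sqrt by blast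
  then have "s \<noteq> 0" using dX by auto
  have "?P (emb (pscale s X))"
    by (intro exI[of _ "coef s"])
       (use s dX \<open>s \<noteq> 0\<close> in \<open>simp add: coef_eq_kzero_iff kscale_emb kdet_emb pdet_pscale coef_simps(2)\<close>)
  then have "?P (SOME A'. ?P A')" by (rule someI)
  then obtain f where f: "puiseux f" "f \<noteq> kzero" "(SOME A'. ?P A') = kscale f (emb X)"
    "kdet (SOME A'. ?P A') = kone" by blast
  obtain u where "f = coef u" using ex_coef[OF f(1)] by blast
  with f have u: "(SOME A'. ?P A') = emb (pscale u X)" "u \<noteq> 0" "pdet (pscale u X) = 1"
    by (simp_all add: coef_eq_kzero_iff kscale_emb kdet_emb coef_eq_iff flip: one_pser.rep_eq)
  obtain v \<sigma> where v: "lt u v \<sigma>" "\<sigma> \<noteq> 0" using ex_lt u(2) by blast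
  have "lt 1 (v + v + \<omega>) (\<sigma> * \<sigma> * W)"
    using lt_mult[OF lt_mult[OF v(1) v(1)] det(1)] u(3) by (simp add: pdet_pscale)
  then have e: "v + v + \<omega> = 0" "\<sigma> * \<sigma> * W = 1"
    using lt_unique[OF _ lt_1] v det by fastforce+
  have \<mu>: "v + \<mu> = \<mu> - \<omega> / 2" using e(1) by simp
  have "mlt (pscale u X) (v + \<mu>) (cscale \<sigma> B)" "cscale \<sigma> B \<noteq> 0"
    using mlt_pscale[OF v(1) X(1)] X(2) v(2) by (simp_all add: cscale_eq_0_iff)
  note l = lead_emb[OF this]
  have "VALm (emb X) = conept (of_rat (v + \<mu>)) (cscale \<sigma> B)"
    unfolding VALm_def conept_def using dX u(1) l
    by (simp add: kdet_emb coef_eq_kzero_iff Let_def)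
  also have "\<dots> = conept (of_rat (v + \<mu>)) (cscale (inverse (csqrt W)) B)"
  proof (rule conept_sign)
    have "\<sigma> * \<sigma> = inverse W" using e(2) det(2) by (simp add: field_simps)
    then show "\<sigma> * \<sigma> = inverse (csqrt W) * inverse (csqrt W)"
      by (simp add: inverse_csqrt_square)
  qed
  finally show ?thesis unfolding \<mu> .
qed

lemma VALm_emb_singular:
  assumes "mlt X \<mu> B" "B \<noteq> 0" "pdet X = 0"
  shows "VALm (emb X) = cclass B"
  unfolding VALm_def using lead_emb[OF assms(1,2)] assms(3)
  by (simp add: kdet_emb coef_eq_kzero_iff)

lemma VALp_pclass:
  obtains s where "s \<noteq> 0" "VALp (pclass X) = VALm (emb (pscale s X))"
proof -
  have "(SOME A. A \<in> pclass X) \<in> pclass X"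
    by (rule someI[of _ "emb (pscale 1 X)"]) (auto simp: pclass_eq)
  then show ?thesis
    using that unfolding VALp_def pclass_eq by fastforce
qed

text \<open>The selected representative differs by an unknown factor. A factor with leading exponent
  \<open>v\<close> adds \<open>v\<close> to \<open>\<mu>\<close> and \<open>2 * v\<close> to
  \<open>\<omega>\<close>, so the level is unchanged, and the phase changes at most by a
  sign.\<close>

lemma VALp_nonsingular:
  assumes X: "mlt X \<mu> B" "B \<noteq> 0" and det: "lt (pdet X) \<omega> W" "W \<noteq> 0"
  shows "VALp (pclass X) = conept (of_rat (\<mu> - \<omega> / 2)) (cscale (inverse (csqrt W)) B)"
proof -
  obtain s where s: "s \<noteq> 0" "VALp (pclass X) = VALm (emb (pscale s X))"
    by (rule VALp_pclass)
  obtain v \<sigma> where v: "lt s v \<sigma>" "\<sigma> \<noteq> 0" using ex_lt s(1) by blast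
  have "VALp (pclass X) = conept (of_rat (v + \<mu> - (v + v + \<omega>) / 2))
      (cscale (inverse (csqrt (\<sigma> * \<sigma> * W))) (cscale \<sigma> B))"
    unfolding s(2)
  proof (rule VALm_emb_nonsingular)
    show "mlt (pscale s X) (v + \<mu>) (cscale \<sigma> B)"
      by (rule mlt_pscale[OF v(1) X(1)])
    show "lt (pdet (pscale s X)) (v + v + \<omega>) (\<sigma> * \<sigma> * W)"
      unfolding pdet_pscale by (intro lt_mult v det)
  qed (use v X det in \<open>auto simp: cscale_eq_0_iff\<close>)
  also have "v + \<mu> - (v + v + \<omega>) / 2 = \<mu> - \<omega> / 2"
    by (simp add: field_simps)
  also have "conept (of_rat (\<mu> - \<omega> / 2)) (cscale (inverse (csqrt (\<sigma> * \<sigma> * W))) (cscale \<sigma> B))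
      = conept (of_rat (\<mu> - \<omega> / 2)) (cscale (inverse (csqrt W)) B)"
    unfolding cscale_simps
  proof (rule conept_sign)
    have "(inverse (csqrt (\<sigma> * \<sigma> * W)) * \<sigma>) * (inverse (csqrt (\<sigma> * \<sigma> * W)) * \<sigma>)
        = (inverse (csqrt (\<sigma> * \<sigma> * W)) * inverse (csqrt (\<sigma> * \<sigma> * W))) * (\<sigma> * \<sigma>)"
      by (simp only: ac_simps)
    also have "\<dots> = inverse W"
      unfolding inverse_csqrt_square using v(2) by (simp add: field_simps)
    finally show "inverse (csqrt (\<sigma> * \<sigma> * W)) * \<sigma> * (inverse (csqrt (\<sigma> * \<sigma> * W)) * \<sigma>)
        = inverse (csqrt W) * inverse (csqrt W)"
      unfolding inverse_csqrt_square .
  qed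
  finally show ?thesis .
qed

lemma VALp_singular:
  assumes X: "mlt X \<mu> B" "B \<noteq> 0" and det: "pdet X = 0"
  shows "VALp (pclass X) = cclass B"
proof -
  obtain s where s: "s \<noteq> 0" "VALp (pclass X) = VALm (emb (pscale s X))"
    by (rule VALp_pclass)
  obtain v \<sigma> where v: "lt s v \<sigma>" "\<sigma> \<noteq> 0" using ex_lt s(1) by blast
  have "VALm (emb (pscale s X)) = cclass (cscale \<sigma> B)"
    using mlt_pscale[OF v(1) X(1)] X(2) v(2) det
    by (intro VALm_emb_singular) (auto simp: cscale_eq_0_iff pdet_pscale)
  then show ?thesis using s(2) v(2) by (simp add: cclass_cscale)
qed

section \<open>A basis with independent leading matrices\<close>

text \<open>The standard Hermitian product on the four entries, conjugate linear in the first
  argument; \<open>phdot\<close> extends the functional given by a complex matrix linearly to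
  Puiseux matrices.\<close>

fun hdot :: "cmat \<Rightarrow> cmat \<Rightarrow> complex" where
  "hdot (k,l,m,n) (a,b,c,d) = cnj k * a + cnj l * b + cnj m * c + cnj n * d"

fun phdot :: "cmat \<Rightarrow> pmat \<Rightarrow> pser" where
  "phdot (k,l,m,n) (a,b,c,d) = tpow (cnj k) 0 * a + tpow (cnj l) 0 * b + tpow (cnj m) 0 * c
     + tpow (cnj n) 0 * d"

text \<open>The functional has constant coefficients, so it does not shift exponents.\<close>

lemma lt_phdot: "mlt X w B \<Longrightarrow> lt (phdot K X) w (hdot K B)"
  using lt_mult[OF lt_tpow[of _ 0], of _ w]
  by (cases X; cases B; cases K) (auto intro!: lt_add)

lemma phdot_linear:
  "phdot K (X + Y) = phdot K X + phdot K Y"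
  "phdot K (pscale s X) = s * phdot K X"
  by (cases X; cases Y; cases K; auto simp: algebra_simps)+

lemma hdot_linear:
  "hdot K (X + Y) = hdot K X + hdot K Y"
  "hdot K (cscale s X) = s * hdot K X"
  by (cases X; cases Y; cases K; auto simp: algebra_simps)+

lemma hdot_self_nonzero:
  assumes "K \<noteq> 0"
  shows "hdot K K \<noteq> 0"
proof -
  obtain k l m n where K: "K = (k,l,m,n)" by (cases K)
  have "hdot K K = of_real ((cmod k)\<^sup>2 + (cmod l)\<^sup>2 + (cmod m)\<^sup>2 + (cmod n)\<^sup>2)"
    unfolding K by (simp add: complex_norm_square mult.commute del: of_real_power)
  moreover have "(cmod k)\<^sup>2 + (cmod l)\<^sup>2 + (cmod m)\<^sup>2 + (cmod n)\<^sup>2 \<noteq> 0"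
    using assms unfolding K by (auto simp: zero_prod_def add_nonneg_eq_0_iff)
  ultimately show ?thesis by (metis of_real_eq_0_iff)
qed

lemma hdot_commute: "hdot X Y = cnj (hdot Y X)"
  by (cases X; cases Y) (simp add: mult.commute)

lemma ppol_comb:
  "ppol (pscale a A + pscale b B) (pscale c A + pscale d B)
    = 2 * a * c * pdet A + (a * d + b * c) * ppol A B + 2 * b * d * pdet B"
  by (cases A; cases B) (auto simp: algebra_simps)

text \<open>Subtracting the multiple of $A$ that kills the constant-coefficient functional
  $\langle A_0, \cdot\rangle$ makes the leading matrix of the second generator orthogonal to $A_0$,
  hence independent of it.\<close>

lemma adapted_basis:
  assumes "is_kline L" "card (L \<inter> QK) = 2"
  obtains A E A0 E0 where "L = pline A E" "mlt A 0 A0" "mlt E 0 E0" "A0 \<noteq> 0" "E0 \<noteq> 0"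
    "hdot A0 E0 = 0" "pdet A = 0" "ppol A E \<noteq> 0"
proof -
  obtain A B where AB: "indep A B" "L = pline A B" "pdet A = 0" "pdet B = 0" "ppol A B \<noteq> 0"
    using two_isotropic_generators[OF assms] .
  have "A \<noteq> 0"
    using indep_nonzero[OF AB(1), of 1 0] by (simp add: pscale_simps)
  then obtain w A0 where A0: "mlt A w A0" "A0 \<noteq> 0" by (rule ex_mlt)
  define s where "s = - (phdot A0 B / phdot A0 A)"
  \<comment> \<open>Its coefficient at exponent \<open>w\<close> is the squared norm of
    \<open>A0\<close>, so the projection coefficient \<open>s\<close> is well defined.\<close>
  have hA: "phdot A0 A \<noteq> 0"
    using lt_nonzero[OF lt_phdot[OF A0(1), of A0]] hdot_self_nonzero[OF A0(2)] by blast
  define C where "C = pscale s A + pscale 1 B"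
  have "C \<noteq> 0"
    unfolding C_def using indep_nonzero[OF AB(1), of s 1] by simp
  then obtain v E0 where E0: "mlt C v E0" "E0 \<noteq> 0" by (rule ex_mlt)
  have "phdot A0 C = 0"
    using hA by (simp add: C_def phdot_linear s_def)
  then have orth: "hdot A0 E0 = 0"
    using lt_phdot[OF E0(1), of A0] by (auto simp: lt_def)
  \<comment> \<open>Monomial factors move both leading exponents to 0 without changing the leading
    matrices.\<close>
  define \<tau> where "\<tau> = tpow 1 (- w)"
  define \<sigma> where "\<sigma> = tpow 1 (- v)"
  have nz: "\<tau> \<noteq> 0" "\<sigma> \<noteq> 0"
    unfolding \<tau>_def \<sigma>_def using lt_nonzero[OF lt_tpow] by simp_all
  have A': "pscale \<tau> A = pscale \<tau> A + pscale 0 B"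
    by (simp add: pscale_simps)
  have C': "pscale \<sigma> C = pscale (\<sigma> * s) A + pscale \<sigma> B"
    by (simp add: C_def pscale_simps)
  have "pline (pscale \<tau> A) (pscale \<sigma> C) = pline A B"
    by (rule pline_change_basis[OF A' C']) (use nz in simp)
  moreover have "ppol (pscale \<tau> A) (pscale \<sigma> C) \<noteq> 0"
    unfolding C' by (subst A', subst ppol_comb) (use nz AB in simp)
  moreover have "mlt (pscale \<tau> A) 0 A0" "mlt (pscale \<sigma> C) 0 E0"
    using mlt_pscale[OF lt_tpow A0(1), of 1 "- w"] mlt_pscale[OF lt_tpow E0(1), of 1 "- v"]
    by (simp_all add: \<tau>_def \<sigma>_def cscale_simps)
  ultimately show ?thesis
    using that A0(2) E0(2) orth AB by (metis mult_zero_right pdet_pscale)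
qed

section \<open>A line in adapted coordinates and its image under the valuation\<close>

lemma lt_square_root:
  assumes "lt (u * u) 0 0"
  shows "lt u 0 0"
proof (cases "u = 0")
  case False
  then obtain v a where v: "lt u v a" "a \<noteq> 0" by (rule ex_lt)
  then have "lt (u * u) (v + v) (a * a)" by (intro lt_mult)
  \<comment> \<open>Otherwise the nonzero coefficient \<open>a * a\<close> would sit at the exponent
    \<open>v + v \<ge> 0\<close>.\<close>
  then have "v < 0"
    using assms v(2) unfolding lt_def
    by (metis add_nonneg_nonneg mult_eq_0_iff not_less order_le_less)
  then show ?thesis using v lt_weaken by blast
qed (simp add: lt_0)

text \<open>One of \<open>c0\<close> and \<open>g0\<close> may vanish, but not both. The case
  \<open>c0 = 0\<close> is exactly that of a double zero, where \<open>p = q\<close>.\<close>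

locale adapted_line =
  fixes A E :: pmat and A0 E0 :: cmat and c g :: pser and \<rho> :: rat and c0 g0 :: complex
  assumes A: "mlt A 0 A0" and E: "mlt E 0 E0" and A0: "A0 \<noteq> 0" and E0: "E0 \<noteq> 0"
    and orth: "hdot A0 E0 = 0"
    and det: "pdet (pscale x A + pscale y E) = y * (c * x + g * y)"
    and c_def: "c = ppol A E" and g_def: "g = pdet E"
    and c: "lt c (- 2 * \<rho>) c0" and g: "lt g (- 2 * \<rho>) g0" and cg0: "(c0, g0) \<noteq> (0, 0)"
    and c_nz: "c \<noteq> 0"
begin

definition M :: "complex \<Rightarrow> complex \<Rightarrow> cmat" where
  "M x y = cscale x A0 + cscale y E0"

definition q0 :: "complex \<Rightarrow> complex \<Rightarrow> complex" where
  "q0 x y = y * (c0 * x + g0 * y)"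

definition p :: "cmat set" where "p = cclass A0"

text \<open>The coordinates \<open>(g0, - c0)\<close> annihilate the factor
  \<open>c0 * x + g0 * y\<close>; the point \<open>p\<close> comes from the factor
  \<open>y\<close>.\<close>

definition q :: "cmat set" where "q = cclass (M g0 (- c0))"

lemma orth': "hdot E0 A0 = 0"
  using orth hdot_commute by (metis complex_cnj_zero)

lemma hdot_M: "hdot A0 (M x y) = x * hdot A0 A0" "hdot E0 (M x y) = y * hdot E0 E0"
  by (simp_all add: M_def hdot_linear orth orth')

lemma M_eq_0_iff: "M x y = 0 \<longleftrightarrow> x = 0 \<and> y = 0"
proof
  assume "M x y = 0"
  then have "M x y = cscale 0 (M x y)" by (simp add: cscale_simps)
  then have "hdot A0 (M x y) = 0" "hdot E0 (M x y) = 0"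
    by (metis hdot_linear(2) mult_zero_left)+
  then show "x = 0 \<and> y = 0"
    using hdot_M hdot_self_nonzero A0 E0 by auto
qed (simp add: M_def cscale_simps)

lemma cscale_M: "cscale s (M x y) = M (s * x) (s * y)"
  by (simp add: M_def cscale_simps)

lemma q0_scale: "q0 (s * x) (s * y) = s * s * q0 x y"
  by (simp add: q0_def algebra_simps)

lemma cdet_A0: "cdet A0 = 0"
proof -
  have "pdet A = pdet (pscale 1 A + pscale 0 E)"
    by (simp add: pscale_simps)
  then have "pdet A = 0" unfolding det by simp
  then show ?thesis using mlt_pdet[OF A] by (auto simp: lt_def)
qed

lemma lt_forms: "lt c 0 (cpol A0 E0)" "lt g 0 (cdet E0)"
  using mlt_ppol[OF A E] mlt_pdet[OF E] by (simp_all add: c_def g_def)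

text \<open>Both generators have leading exponent 0, so \<open>c\<close> and \<open>g\<close> have
  no positive exponents.\<close>

lemma rho_nonneg: "\<rho> \<ge> 0"
proof (rule ccontr)
  assume "\<not> \<rho> \<ge> 0"
  then have "c0 = 0" "g0 = 0"
    using lt_forms c g unfolding lt_def by auto
  then show False using cg0 by simp
qed

text \<open>The coefficients of the complex determinant on the reduced plane are those of
  \<open>c\<close> and \<open>g\<close> at exponent 0. They coincide with \<open>c0\<close> and
  \<open>g0\<close> if \<open>\<rho> = 0\<close>, and vanish if \<open>\<rho> > 0\<close>; this
  decides whether the reduced line lies in the quadric.\<close>

lemma cdet_M:
  shows "\<rho> = 0 \<Longrightarrow> cdet (M x y) = q0 x y" and "\<rho> > 0 \<Longrightarrow> cdet (M x y) = 0"
proof -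
  assume "\<rho> = 0"
  then have "cpol A0 E0 = c0" "cdet E0 = g0"
    using lt_forms c g unfolding lt_def by auto
  then show "cdet (M x y) = q0 x y"
    unfolding M_def cdet_comb q0_def by (simp add: cdet_A0 algebra_simps)
next
  assume "\<rho> > 0"
  then have "cpol A0 E0 = 0" "cdet E0 = 0"
    using lt_forms c g unfolding lt_def by auto
  then show "cdet (M x y) = 0"
    unfolding M_def cdet_comb by (simp add: cdet_A0)
qed

lemma p_eq: "p = cclass (M 1 0)"
  by (simp add: p_def M_def cscale_simps)

lemma q_eq_p: "c0 = 0 \<Longrightarrow> q = p"
  unfolding q_def p_def using cg0 by (simp add: M_def cscale_simps cclass_cscale)

lemma cclass_M_eq_iff:
  "cclass (M x y) = cclass (M x' y') \<longleftrightarrow> (\<exists>s. s \<noteq> 0 \<and> x' = s * x \<and> y' = s * y)"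
proof -
  have "M x' y' = cscale s (M x y) \<longleftrightarrow> x' = s * x \<and> y' = s * y" for s
  proof
    assume "M x' y' = cscale s (M x y)"
    then have "hdot A0 (M x' y') = hdot A0 (M (s * x) (s * y))"
      "hdot E0 (M x' y') = hdot E0 (M (s * x) (s * y))"
      by (simp_all add: cscale_M)
    then show "x' = s * x \<and> y' = s * y"
      using hdot_self_nonzero A0 E0 by (auto simp: hdot_M)
  qed (simp add: cscale_M)
  then show ?thesis unfolding cclass_eq_iff by simp
qed

lemma q0_eq_0_iff:
  assumes "(x, y) \<noteq> (0, 0)"
  shows "q0 x y = 0 \<longleftrightarrow> cclass (M x y) \<in> {p, q}"
proof
  assume 0: "q0 x y = 0"
  show "cclass (M x y) \<in> {p, q}"
  proof (cases "y = 0")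
    case True
    then have "cclass (M 1 0) = cclass (M x y)"
      unfolding cclass_M_eq_iff using assms by (intro exI[of _ x]) auto
    then show ?thesis by (simp add: p_eq)
  next
    case False
    then have e: "c0 * x = - (g0 * y)"
      using 0 by (simp add: q0_def eq_neg_iff_add_eq_0)
    then have "c0 \<noteq> 0" using False cg0 by auto
    then have "x = - y / c0 * g0"
      using e by (simp add: field_simps)
    then have "cclass (M g0 (- c0)) = cclass (M x y)"
      unfolding cclass_M_eq_iff using False \<open>c0 \<noteq> 0\<close> by (intro exI[of _ "- y / c0"]) auto
    then show ?thesis by (simp add: q_def)
  qed
next
  assume "cclass (M x y) \<in> {p, q}"
  then consider s where "x = s * 1" "y = s * 0" | s where "x = s * g0" "y = s * - c0"
    unfolding p_eq q_def using cclass_M_eq_iff by (metis insertE singletonD)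
  then show "q0 x y = 0"
    by cases (simp_all add: q0_def)
qed

lemma mlt_comb: "lt x 0 x0 \<Longrightarrow> lt y 0 y0 \<Longrightarrow> mlt (pscale x A + pscale y E) 0 (M x0 y0)"
  unfolding M_def using mlt_add[OF mlt_pscale[OF _ A] mlt_pscale[OF _ E]] by fastforce

lemma normalized_representative:
  assumes "P \<in> pline A E"
  obtains x y x0 y0 where "lt x 0 x0" "lt y 0 y0" "(x0, y0) \<noteq> (0, 0)"
    "P = pclass (pscale x A + pscale y E)"
proof -
  obtain x y where xy: "P = pclass (pscale x A + pscale y E)" "(x, y) \<noteq> (0, 0)"
    using assms unfolding pline_def by blast
  obtain w where w: "\<forall>f\<in>set [x, y]. \<exists>a. lt f w a" "\<exists>f\<in>set [x, y]. coef f w \<noteq> 0"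
    using list_leading[of "[x, y]"] xy(2) by auto
  obtain a b where ab: "lt x w a" "lt y w b" using w(1) by auto
  have nz: "(a, b) \<noteq> (0, 0)" using w(2) ab by (auto simp: lt_def)
  define s where "s = tpow 1 (- w)"
  have "s \<noteq> 0" unfolding s_def using lt_nonzero[OF lt_tpow] by simp
  have "lt (s * x) 0 a" "lt (s * y) 0 b"
    using lt_mult[OF lt_tpow ab(1), of 1 "- w"] lt_mult[OF lt_tpow ab(2), of 1 "- w"]
    by (simp_all add: s_def)
  moreover have "P = pclass (pscale (s * x) A + pscale (s * y) E)"
    using pclass_pscale[OF \<open>s \<noteq> 0\<close>, of "pscale x A + pscale y E"] xy(1)
    by (simp add: pscale_simps)
  ultimately show ?thesis using that nz by blast
qed

lemma pclass_comb_in_pline: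
  assumes "lt x 0 x0" "lt y 0 y0" "(x0, y0) \<noteq> (0, 0)"
  shows "pclass (pscale x A + pscale y E) \<in> pline A E"
  using assms lt_nonzero unfolding pline_def by blast

lemma lt_q:
  assumes "lt x 0 x0" "lt y 0 y0"
  shows "lt (y * (c * x + g * y)) (- 2 * \<rho>) (q0 x0 y0)"
proof -
  have "lt (c * x + g * y) (- 2 * \<rho>) (c0 * x0 + g0 * y0)"
    using lt_mult[OF c assms(1)] lt_mult[OF g assms(2)] by (auto intro!: lt_add)
  then show ?thesis
    using lt_mult[OF assms(2)] unfolding q0_def by fastforce
qed

text \<open>Attaining a given level and phase is reduced to one scalar equation: the determinant
  must have leading coefficient \<open>W = 1 / (b * b)\<close> at exponent
  \<open>- 2 * a\<close>.\<close>

lemma conept_in_VALp_image: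
  assumes xy: "lt x 0 x0" "lt y 0 y0" "(x0, y0) \<noteq> (0, 0)"
    and q: "lt (y * (c * x + g * y)) (- 2 * a) W" "b * b * W = 1"
  shows "conept (of_rat a) (cscale b (M x0 y0)) \<in> VALp ` pline A E"
proof -
  have "W \<noteq> 0" using q(2) by auto
  let ?X = "pscale x A + pscale y E"
  have "VALp (pclass ?X) = conept (of_rat (0 - (- 2 * a) / 2)) (cscale (inverse (csqrt W)) (M x0 y0))"
    using xy q(1) \<open>W \<noteq> 0\<close>
    by (intro VALp_nonsingular mlt_comb) (auto simp: M_eq_0_iff det)
  also have "\<dots> = conept (of_rat a) (cscale b (M x0 y0))"
  proof -
    have "b * b = inverse W" using q(2) \<open>W \<noteq> 0\<close> by (simp add: field_simps)
    then show ?thesis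
      using conept_sign[of "inverse (csqrt W)" b] by (simp add: inverse_csqrt_square)
  qed
  finally show ?thesis using pclass_comb_in_pline[OF xy] by (metis image_eqI)
qed

lemma VALp_image_sub:
  assumes "P \<in> pline A E"
  shows "(\<exists>x y. q0 x y \<noteq> 0 \<and>
            VALp P = conept (of_rat \<rho>) (cscale (inverse (csqrt (q0 x y))) (M x y)))
    \<or> (\<exists>\<alpha> B. \<alpha> \<in> \<rat> \<and> \<alpha> > of_rat \<rho> \<and> B \<noteq> 0 \<and> cclass B \<in> {p, q} \<and> VALp P = conept \<alpha> B)
    \<or> VALp P \<in> {p, q}"
proof -
  obtain x y x0 y0 where xy: "lt x 0 x0" "lt y 0 y0" "(x0, y0) \<noteq> (0, 0)"
    and P: "P = pclass (pscale x A + pscale y E)"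
    using normalized_representative[OF assms] .
  let ?X = "pscale x A + pscale y E"
  have X: "mlt ?X 0 (M x0 y0)" "M x0 y0 \<noteq> 0"
    using mlt_comb[OF xy(1,2)] xy(3) by (auto simp: M_eq_0_iff)
  have dX: "lt (pdet ?X) (- 2 * \<rho>) (q0 x0 y0)"
    unfolding det using lt_q[OF xy(1,2)] .
  show ?thesis
  proof (cases "q0 x0 y0 = 0")
    case False
    then have "VALp P = conept (of_rat \<rho>) (cscale (inverse (csqrt (q0 x0 y0))) (M x0 y0))"
      using VALp_nonsingular[OF X dX] P by simp
    then show ?thesis using False by blast
  next
    case True
    then have pq: "cclass (M x0 y0) \<in> {p, q}" using q0_eq_0_iff[OF xy(3)] by blast
    show ?thesis
    proof (cases "pdet ?X = 0")
      case True
      then show ?thesis using VALp_singular[OF X] pq P by simp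
    next
      case False
      then obtain w W where w: "lt (pdet ?X) w W" "W \<noteq> 0" by (rule ex_lt)
      \<comment> \<open>The coefficient at \<open>- 2 * \<rho>\<close> is
        \<open>q0 x0 y0 = 0\<close>, so the determinant starts strictly lower and the level
        \<open>- w / 2\<close> is strictly above \<open>\<rho>\<close>.\<close>
      have "w < - 2 * \<rho>"
        using dX w True unfolding lt_def by (metis linorder_neqE)
      then have "\<rho> < 0 - w / 2" by simp
      then have "of_rat \<rho> < (of_rat (0 - w / 2) :: real)" by (simp only: of_rat_less)
      moreover have "cclass (cscale (inverse (csqrt W)) (M x0 y0)) \<in> {p, q}"
        using pq w(2) by (subst cclass_cscale) auto
      moreover have "cscale (inverse (csqrt W)) (M x0 y0) \<noteq> 0"
        using X(2) w(2) by (simp add: cscale_eq_0_iff)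
      ultimately show ?thesis
        using VALp_nonsingular[OF X w] unfolding P
        by (metis (no_types, lifting) Rats_of_rat)
    qed
  qed
qed

lemma attained_at_level_rho:
  assumes "q0 x y \<noteq> 0"
  shows "conept (of_rat \<rho>) (cscale (inverse (csqrt (q0 x y))) (M x y)) \<in> VALp ` pline A E"
proof (rule conept_in_VALp_image)
  show "lt (tpow x 0) 0 x" "lt (tpow y 0) 0 y" by (rule lt_tpow)+
  then show "lt (tpow y 0 * (c * tpow x 0 + g * tpow y 0)) (- 2 * \<rho>) (q0 x y)"
    by (rule lt_q)
  show "(x, y) \<noteq> (0, 0)" using assms by (auto simp: q0_def)
  show "inverse (csqrt (q0 x y)) * inverse (csqrt (q0 x y)) * q0 x y = 1"
    using assms by (simp add: inverse_csqrt_square)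
qed

lemma p_attained: "p \<in> VALp ` pline A E"
proof -
  have "VALp (pclass (pscale 1 A + pscale 0 E)) = cclass (M 1 0)"
    by (rule VALp_singular[OF mlt_comb[OF lt_1 lt_0]]) (simp_all add: M_eq_0_iff det)
  then show ?thesis
    unfolding p_eq using pclass_comb_in_pline[OF lt_1 lt_0] by (metis image_eqI prod.inject zero_neq_one)
qed

text \<open>The vector \<open>(g, - c)\<close> is the second exact zero of the form over the Puiseux
  field; the factor \<open>tpow 1 (2 * \<rho>)\<close> brings it to exponent 0, where it reduces to
  \<open>q\<close>.\<close>

lemma q_lift: "lt (tpow 1 (2 * \<rho>) * g) 0 g0" "lt (- (tpow 1 (2 * \<rho>) * c)) 0 (- c0)"
  using lt_mult[OF lt_tpow g, of 1 "2 * \<rho>"] lt_uminus[OF lt_mult[OF lt_tpow c, of 1 "2 * \<rho>"]]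
  by simp_all

lemma q_attained: "q \<in> VALp ` pline A E"
proof -
  let ?x = "tpow 1 (2 * \<rho>) * g" and ?y = "- (tpow 1 (2 * \<rho>) * c)"
  have nz: "(g0, - c0) \<noteq> (0, 0)" using cg0 by auto
  have "VALp (pclass (pscale ?x A + pscale ?y E)) = cclass (M g0 (- c0))"
  proof (rule VALp_singular[OF mlt_comb[OF q_lift]])
    show "M g0 (- c0) \<noteq> 0" using nz by (auto simp: M_eq_0_iff)
    show "pdet (pscale ?x A + pscale ?y E) = 0" unfolding det by (simp add: algebra_simps)
  qed
  then show ?thesis
    unfolding q_def using pclass_comb_in_pline[OF q_lift nz] by (metis image_eqI)
qed

text \<open>The equation \<open>y * (c * x + g * y) = T\<close> is solved exactly with
  \<open>(x, y)\<close> reducing to \<open>(1, 0)\<close>. At a simple zero it can be made linear;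
  at a double zero a square root is extracted. In both cases \<open>a > \<rho>\<close> makes
  \<open>y\<close> small.\<close>

lemma attained_near_p:
  assumes "a > \<rho>" "b \<noteq> 0"
  shows "conept (of_rat a) (cscale b (M 1 0)) \<in> VALp ` pline A E"
proof -
  define W where "W = 1 / (b * b)"
  define T where "T = tpow W (- 2 * a)"
  have T: "lt T (- 2 * a) W" unfolding T_def by (rule lt_tpow)
  have W: "b * b * W = 1" using assms(2) by (simp add: W_def)
  have "\<exists>x y. lt x 0 1 \<and> lt y 0 0 \<and> y * (c * x + g * y) = T"
  proof (cases "c0 = 0")
    case False
    \<comment> \<open>With \<open>x = 1 - y * (g / c)\<close> the second factor
      \<open>c * x + g * y\<close> becomes exactly \<open>c\<close>, so no quadratic equation
      remains.\<close>
    define y where "y = T / c"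
    have "lt y (- 2 * a - (- 2 * \<rho>)) (W / c0)"
      unfolding y_def using T c False by (rule lt_divide)
    then have y: "lt y 0 0" by (rule lt_weaken) (use assms in simp)
    have "lt (g / c) 0 (g0 / c0)"
      using lt_divide[OF g c False] by simp
    then have "lt (y * (g / c)) 0 0"
      using lt_mult[OF y] by fastforce
    then have "lt (1 - y * (g / c)) 0 1"
      using lt_diff[OF lt_1] by fastforce
    moreover have "y * (c * (1 - y * (g / c)) + g * y) = T"
      using c_nz by (simp add: y_def field_simps)
    ultimately show ?thesis using y by blast
  next
    case True
    then have "g0 \<noteq> 0" using cg0 by simp
    then have "g \<noteq> 0" using lt_nonzero g by blast
    \<comment> \<open>With \<open>x = 1\<close>, completing the square gives
      \<open>y = u - h\<close>. Here \<open>c0 = 0\<close> makes \<open>h\<close> small, and then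
      \<open>u\<close> is small for either sign of the root.\<close>
    define h where "h = c / (g + g)"
    obtain u where u: "u * u = T / g + h * h" using ex_pser_sqrt by blast
    have gg: "lt (g + g) (- 2 * \<rho>) (g0 + g0)" "g0 + g0 \<noteq> 0"
      using lt_add[OF g g] \<open>g0 \<noteq> 0\<close> by auto
    then have h: "lt h 0 0"
      unfolding h_def using lt_divide[OF c gg] True by simp
    have "lt (T / g) (- 2 * a - (- 2 * \<rho>)) (W / g0)"
      using T g \<open>g0 \<noteq> 0\<close> by (rule lt_divide)
    then have "lt (T / g) 0 0" by (rule lt_weaken) (use assms in simp)
    moreover have "lt (h * h) 0 0" using lt_mult[OF h h] by simp
    ultimately have "lt (u * u) 0 0"
      unfolding u using lt_add by fastforce
    then have "lt (u - h) 0 0"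
      using lt_diff[OF lt_square_root h] by fastforce
    moreover have "(u - h) * (c * 1 + g * (u - h)) = T"
    proof -
      have "c = (g + g) * h" using lt_nonzero[OF gg] by (simp add: h_def)
      then have "(u - h) * (c * 1 + g * (u - h)) = g * (u * u) - g * (h * h)"
        by (simp add: algebra_simps)
      also have "\<dots> = T" unfolding u using \<open>g \<noteq> 0\<close> by (simp add: field_simps)
      finally show ?thesis .
    qed
    ultimately show ?thesis using lt_1 by blast
  qed
  then obtain x y where "lt x 0 1" "lt y 0 0" "y * (c * x + g * y) = T" by blast
  then show ?thesis
    using T W by (intro conept_in_VALp_image) auto
qed

text \<open>The coordinate \<open>y = - (S * c)\<close> of the exact zero is kept and only
  \<open>x\<close> is moved by \<open>z\<close>. Then \<open>c * x + g * y = c * z\<close>, so the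
  equation for \<open>z\<close> is linear.\<close>

lemma attained_near_q:
  assumes "a > \<rho>" "b \<noteq> 0" "c0 \<noteq> 0"
  shows "conept (of_rat a) (cscale b (M g0 (- c0))) \<in> VALp ` pline A E"
proof -
  define W where "W = 1 / (b * b)"
  define T where "T = tpow W (- 2 * a)"
  define S where "S = tpow 1 (2 * \<rho>)"
  have T: "lt T (- 2 * a) W" and S: "lt S (2 * \<rho>) 1"
    unfolding T_def S_def by (rule lt_tpow)+
  have "S \<noteq> 0" using S lt_nonzero by auto
  define z where "z = - (T / (S * (c * c)))"
  have "lt (S * (c * c)) (2 * \<rho> + (- 2 * \<rho> + - 2 * \<rho>)) (1 * (c0 * c0))"
    by (intro lt_mult S c)
  then have "lt (T / (S * (c * c))) (- 2 * a - (2 * \<rho> + (- 2 * \<rho> + - 2 * \<rho>))) (W / (1 * (c0 * c0)))"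
    using assms(3) by (intro lt_divide T) auto
  \<comment> \<open>The exponents add up to \<open>2 * (\<rho> - a)\<close>, which is
    negative.\<close>
  then have "lt (T / (S * (c * c))) 0 0"
    by (rule lt_weaken) (use assms in simp)
  then have z: "lt z 0 0"
    unfolding z_def using lt_uminus by fastforce
  show ?thesis
  proof (rule conept_in_VALp_image)
    show "lt (S * g + z) 0 g0"
      using lt_add[OF q_lift(1) z] by (simp add: S_def)
    show "lt (- (S * c)) 0 (- c0)"
      using q_lift(2) by (simp add: S_def)
    have "- (S * c) * (c * (S * g + z) + g * - (S * c)) = - (S * (c * c) * z)"
      by (simp add: algebra_simps)
    also have "\<dots> = T"
      using \<open>S \<noteq> 0\<close> c_nz by (simp add: z_def)
    finally show "lt (- (S * c) * (c * (S * g + z) + g * - (S * c))) (- 2 * a) W"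
      using T by simp
    show "(g0, - c0) \<noteq> (0, 0)" using assms by simp
    show "b * b * W = 1" using assms by (simp add: W_def)
  qed
qed

lemma attained_above_rho:
  assumes "\<alpha> \<in> \<rat>" "\<alpha> > of_rat \<rho>" "cclass B \<in> {p, q}"
  shows "conept \<alpha> B \<in> VALp ` pline A E"
proof -
  obtain a where a: "\<alpha> = of_rat a" using assms(1) by (auto elim: Rats_cases)
  then have "a > \<rho>" using assms(2) by (simp add: of_rat_less)
  show ?thesis
  proof (cases "cclass B = p")
    case True
    then obtain b where "b \<noteq> 0" "B = cscale b (M 1 0)"
      unfolding p_eq by (metis cclass_eq_iff)
    then show ?thesis using attained_near_p[OF \<open>a > \<rho>\<close>] a by simp
  next
    case False
    \<comment> \<open>A vanishing \<open>c0\<close> would give \<open>q = p\<close>, which is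
      already covered.\<close>
    then have "cclass B = q" "c0 \<noteq> 0" using assms(3) q_eq_p by auto
    moreover from this obtain b where "b \<noteq> 0" "B = cscale b (M g0 (- c0))"
      unfolding q_def by (metis cclass_eq_iff)
    ultimately show ?thesis using attained_near_q[OF \<open>a > \<rho>\<close>] a by simp
  qed
qed

lemma VALp_image:
  "VALp ` pline A E =
     {conept (of_rat \<rho>) (cscale (inverse (csqrt (q0 x y))) (M x y)) | x y. q0 x y \<noteq> 0}
     \<union> {conept \<alpha> B | \<alpha> B. \<alpha> \<in> \<rat> \<and> \<alpha> > of_rat \<rho> \<and> B \<noteq> 0 \<and> cclass B \<in> {p, q}}
     \<union> {p, q}" (is "_ = ?R")
proof
  show "VALp ` pline A E \<subseteq> ?R"
  proof
    fix Y assume "Y \<in> VALp ` pline A E"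
    then obtain P where "P \<in> pline A E" "Y = VALp P" by blast
    then show "Y \<in> ?R" using VALp_image_sub[of P] by blast
  qed
  show "?R \<subseteq> VALp ` pline A E"
    using attained_at_level_rho attained_above_rho p_attained q_attained by auto
qed

end

lemma ex_adapted_line:
  assumes "is_kline L" "card (L \<inter> QK) = 2"
  obtains A E A0 E0 c g \<rho> c0 g0 where "adapted_line A E A0 E0 c g \<rho> c0 g0" "L = pline A E"
proof -
  obtain A E A0 E0 where *: "L = pline A E" "mlt A 0 A0" "mlt E 0 E0" "A0 \<noteq> 0" "E0 \<noteq> 0"
    "hdot A0 E0 = 0" "pdet A = 0" "ppol A E \<noteq> 0"
    using adapted_basis[OF assms] .
  \<comment> \<open>The nonzero polar product excludes the case of an identically zero form.\<close>
  obtain w where w: "\<forall>f\<in>set [ppol A E, pdet E]. \<exists>a. lt f w a"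
    "\<exists>f\<in>set [ppol A E, pdet E]. coef f w \<noteq> 0"
    using list_leading[of "[ppol A E, pdet E]"] *(8) by auto
  obtain a b where ab: "lt (ppol A E) w a" "lt (pdet E) w b" using w(1) by auto
  have nz: "(a, b) \<noteq> (0, 0)" using w(2) ab by (auto simp: lt_def)
  have "adapted_line A E A0 E0 (ppol A E) (pdet E) (- w / 2) a b"
    by unfold_locales (use * ab nz in \<open>auto simp: pdet_comb algebra_simps\<close>)
  then show ?thesis using that *(1) by blast
qed

section \<open>Real and complex classes, cones and quotient topologies\<close>

lemma conept_scaleR:
  assumes "r \<noteq> 0"
  shows "conept \<alpha> (r *\<^sub>R B) = conept \<alpha> B"
proof -
  have "exp \<alpha> *\<^sub>R (r *\<^sub>R B) + exp (- \<alpha>) *\<^sub>R cctr (cadj (r *\<^sub>R B))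
      = cscale (of_real r) (exp \<alpha> *\<^sub>R B + exp (- \<alpha>) *\<^sub>R cctr (cadj B))"
    by (cases B) (simp add: scaleR_conv_of_real algebra_simps)
  then show ?thesis
    unfolding conept_def using assms by (simp add: cclass_cscale)
qed

lemma cone_eq: "cone I T = {conept \<alpha> B | \<alpha> B. \<alpha> \<in> I \<and> rclass B \<in> T}"
  by (simp add: cone_def conept_def)

lemma rclass_eq_iff: "rclass X = rclass Y \<longleftrightarrow> (\<exists>r. r \<noteq> 0 \<and> Y = r *\<^sub>R X)"
proof
  assume "rclass X = rclass Y"
  moreover have "Y \<in> rclass Y"
    unfolding rclass_def by (auto intro!: exI[of _ 1])
  ultimately have "Y \<in> rclass X" by simp
  then show "\<exists>r. r \<noteq> 0 \<and> Y = r *\<^sub>R X"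
    unfolding rclass_def by blast
next
  assume "\<exists>r. r \<noteq> 0 \<and> Y = r *\<^sub>R X"
  then obtain r where r: "r \<noteq> 0" "Y = r *\<^sub>R X" by blast
  show "rclass X = rclass Y"
    unfolding rclass_def
  proof (intro subset_antisym subsetI; clarsimp)
    fix u assume "u \<noteq> (0::real)"
    then show "\<exists>v. u *\<^sub>R X = v *\<^sub>R Y \<and> v \<noteq> 0"
      using r by (intro exI[of _ "u / r"]) auto
  next
    fix u assume "u \<noteq> (0::real)"
    then show "\<exists>v. u *\<^sub>R Y = v *\<^sub>R X \<and> v \<noteq> 0"
      using r by (intro exI[of _ "u * r"]) auto
  qed
qed

lemma rclass_sign:
  assumes "a * a = b * (b::complex)"
  shows "rclass (cscale a B) = rclass (cscale b B)"
proof -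
  have "rclass (- X) = rclass X" for X
    unfolding rclass_eq_iff by (intro exI[of _ "-1"]) simp
  moreover have "a = b \<or> a = - b" using assms by (simp add: square_eq_iff)
  ultimately show ?thesis by (elim disjE) (simp_all only: cscale_simps(7))
qed

lemma scaleR_cscale: "r *\<^sub>R X = cscale (of_real r) X"
  by (cases X) (simp add: scaleR_conv_of_real)

lemma piS_rclass: "piS (rclass B) = cclass B"
proof -
  have "(SOME C. C \<in> rclass B) \<in> rclass B"
    by (rule someI[of _ "1 *\<^sub>R B"], unfold rclass_def) (intro CollectI exI[of _ 1], simp)
  then obtain r where "(SOME C. C \<in> rclass B) = r *\<^sub>R B" "r \<noteq> 0"
    unfolding rclass_def by blast
  then show ?thesis
    unfolding piS_def by (simp add: scaleR_cscale cclass_cscale)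
qed

lemma rclass_in_Sb_iff: "rclass B \<in> Sb \<longleftrightarrow> B \<noteq> 0 \<and> cdet B = 0"
proof
  assume "rclass B \<in> Sb"
  then obtain C where "rclass C = rclass B" "C \<noteq> 0" "cdet C = 0"
    unfolding Sb_def by blast
  then show "B \<noteq> 0 \<and> cdet B = 0"
    unfolding rclass_eq_iff by (auto simp: scaleR_cscale cdet_cscale cscale_eq_0_iff)
next
  assume "B \<noteq> 0 \<and> cdet B = 0"
  then show "rclass B \<in> Sb" unfolding Sb_def by blast
qed

lemma rclass_in_Srestr_iff:
  "rclass B \<in> Srestr Z \<longleftrightarrow> B \<noteq> 0 \<and> cdet B = 0 \<and> cclass B \<in> Z"
  by (auto simp: Srestr_def rclass_in_Sb_iff piS_rclass)

lemma cclass_in_QC_iff: "cclass X \<in> QC \<longleftrightarrow> X \<noteq> 0 \<and> cdet X = 0"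
proof
  assume "cclass X \<in> QC"
  then obtain Y where "cclass Y = cclass X" "Y \<noteq> 0" "cdet Y = 0"
    unfolding QC_def by auto
  then show "X \<noteq> 0 \<and> cdet X = 0"
    unfolding cclass_eq_iff by (auto simp: cdet_cscale cscale_eq_0_iff)
next
  assume "X \<noteq> 0 \<and> cdet X = 0"
  then show "cclass X \<in> QC" unfolding QC_def by blast
qed

text \<open>Representatives of determinant 1 differ by a sign, so the one selected in
  \<open>kappa\<close> may be replaced by the one obtained with \<open>csqrt\<close>.\<close>

lemma kappa_cclass:
  assumes "cdet X \<noteq> 0"
  shows "kappa (cclass X) = conept 0 (cscale (inverse (csqrt (cdet X))) X)"
proof -
  let ?P = "\<lambda>A. A \<in> cclass X \<and> cdet A = 1"
  have "inverse (csqrt (cdet X)) \<noteq> 0" using assms by simp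
  then have "cscale (inverse (csqrt (cdet X))) X \<in> cclass X"
    unfolding cclass_def by blast
  then have "?P (cscale (inverse (csqrt (cdet X))) X)"
    using assms by (simp add: cdet_cscale inverse_csqrt_square)
  then have *: "?P (SOME A. ?P A)" by (rule someI)
  then obtain s where s: "(SOME A. ?P A) = cscale s X" "s \<noteq> 0"
    unfolding cclass_def by blast
  then have "s * s * cdet X = 1" using * by (simp add: cdet_cscale)
  then have "s * s = inverse (csqrt (cdet X)) * inverse (csqrt (cdet X))"
    using assms unfolding inverse_csqrt_square by (simp add: field_simps)
  then have "conept 0 (cscale s X) = conept 0 (cscale (inverse (csqrt (cdet X))) X)"
    by (rule conept_sign)
  then show ?thesis
    unfolding kappa_def s(1) Let_def by (simp add: conept_def)
qed

section \<open>Quotient topologies\<close>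

lemma openin_qtop:
  "openin (qtop A cls) U \<longleftrightarrow> U \<subseteq> cls ` A \<and> openin (top_of_set A) {x \<in> A. cls x \<in> U}"
proof -
  \<comment> \<open>\<open>topology\<close> inverts \<open>openin\<close> only on predicates
    satisfying \<open>istopology\<close>; this one does because preimages commute with intersections
    and unions.\<close>
  have "istopology (\<lambda>U. U \<subseteq> cls ` A \<and> openin (top_of_set A) {x \<in> A. cls x \<in> U})"
    unfolding istopology_def
  proof (rule conjI; intro allI impI)
    fix S T
    assume "S \<subseteq> cls ` A \<and> openin (top_of_set A) {x \<in> A. cls x \<in> S}"
      and "T \<subseteq> cls ` A \<and> openin (top_of_set A) {x \<in> A. cls x \<in> T}"
    then have S: "S \<inter> T \<subseteq> cls ` A"
      and o: "openin (top_of_set A) {x \<in> A. cls x \<in> S}" "openin (top_of_set A) {x \<in> A. cls x \<in> T}"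
      by blast+
    have "openin (top_of_set A) ({x \<in> A. cls x \<in> S} \<inter> {x \<in> A. cls x \<in> T})"
      using o by (rule openin_Int)
    also have "{x \<in> A. cls x \<in> S} \<inter> {x \<in> A. cls x \<in> T} = {x \<in> A. cls x \<in> S \<inter> T}" by blast
    finally show "S \<inter> T \<subseteq> cls ` A \<and> openin (top_of_set A) {x \<in> A. cls x \<in> S \<inter> T}"
      using S by blast
  next
    fix \<K> assume K: "\<forall>K\<in>\<K>. K \<subseteq> cls ` A \<and> openin (top_of_set A) {x \<in> A. cls x \<in> K}"
    then have "openin (top_of_set A) (\<Union>K\<in>\<K>. {x \<in> A. cls x \<in> K})"
      by (intro openin_Union) blast
    also have "(\<Union>K\<in>\<K>. {x \<in> A. cls x \<in> K}) = {x \<in> A. cls x \<in> \<Union> \<K>}" by blast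
    finally show "\<Union> \<K> \<subseteq> cls ` A \<and> openin (top_of_set A) {x \<in> A. cls x \<in> \<Union> \<K>}"
      using K by blast
  qed
  then show ?thesis
    unfolding qtop_def by (simp add: topology_inverse')
qed

lemma topspace_qtop: "topspace (qtop A cls) = cls ` A"
proof
  show "topspace (qtop A cls) \<subseteq> cls ` A"
    using openin_topspace[of "qtop A cls"] unfolding openin_qtop by blast
  have "{x \<in> A. cls x \<in> cls ` A} = A" by blast
  then have "openin (qtop A cls) (cls ` A)"
    unfolding openin_qtop by simp
  then show "cls ` A \<subseteq> topspace (qtop A cls)" by (rule openin_subset)
qed

lemma continuous_on_cscale [continuous_intros]:
  assumes "continuous_on S f" "continuous_on S g"
  shows "continuous_on S (\<lambda>x. cscale (f x) (g x))"
proof -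
  have eq: "cscale s X = (s * fst X, s * fst (snd X), s * fst (snd (snd X)), s * snd (snd (snd X)))" for s X
    by (cases X) simp
  then show ?thesis
    unfolding eq by (auto intro!: continuous_intros assms)
qed

lemma continuous_on_hdot [continuous_intros]:
  assumes "continuous_on S f"
  shows "continuous_on S (\<lambda>x. hdot K (f x))"
proof -
  obtain k l m n where K: "K = (k,l,m,n)" by (cases K)
  have "hdot K X = cnj k * fst X + cnj l * fst (snd X) + cnj m * fst (snd (snd X))
      + cnj n * snd (snd (snd X))" for X
    unfolding K by (cases X) simp
  then show ?thesis
    by (auto intro!: continuous_intros assms)
qed

section \<open>The section over the line and the four cases\<close>

context adapted_line
begin

abbreviation l :: "cmat set set" where "l \<equiv> cline A0 E0"

lemma l_eq: "l = {cclass (M x y) | x y. (x, y) \<noteq> (0, 0)}"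
  by (simp add: cline_def M_def)

lemma is_cline_l: "is_cline l"
  unfolding is_cline_def using M_eq_0_iff unfolding M_def by blast

lemma p_in_l: "p \<in> l"
  unfolding l_eq p_eq by (intro CollectI exI[of _ 1] exI[of _ 0]) simp

lemma q_in_l: "q \<in> l"
  unfolding l_eq q_def using cg0 by (intro CollectI exI[of _ g0] exI[of _ "- c0"]) auto

lemma l_minus_eq: "l - {p, q} = {cclass (M x y) | x y. q0 x y \<noteq> 0}"
proof -
  have "q0 x y \<noteq> 0 \<longleftrightarrow> (x, y) \<noteq> (0, 0) \<and> cclass (M x y) \<notin> {p, q}" for x y
    using q0_eq_0_iff[of x y] by (cases "(x, y) = (0, 0)") (auto simp: q0_def)
  then show ?thesis unfolding l_eq by (intro set_eqI; unfold Diff_iff mem_Collect_eq) metis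
qed

text \<open>\<open>Srestr\<close> admits only rank one matrices. Both points lie on the quadric: for
  \<open>\<rho> > 0\<close> with the whole line, for \<open>\<rho> = 0\<close> as zeros of
  \<open>q0\<close>, which is then the determinant.\<close>

lemma cdet_roots: "cclass B \<in> {p, q} \<Longrightarrow> cdet B = 0"
proof -
  assume B: "cclass B \<in> {p, q}"
  have "cdet (M g0 (- c0)) = 0"
    using cdet_M[of g0 "- c0"] rho_nonneg by (cases "\<rho> = 0") (auto simp: q0_def)
  moreover obtain s where "B = cscale s A0 \<or> B = cscale s (M g0 (- c0))"
  proof (cases "cclass A0 = cclass B")
    case False
    then have "cclass (M g0 (- c0)) = cclass B" using B by (simp add: p_def q_def)
    then show ?thesis using that unfolding cclass_eq_iff by blast
  qed (use that in \<open>unfold cclass_eq_iff, blast\<close>)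
  ultimately show "cdet B = 0"
    using cdet_A0 by (auto simp: cdet_cscale)
qed

lemma cone_part:
  "cone {\<alpha>. r < \<alpha> \<and> \<alpha> \<in> \<rat>} (Srestr {p, q})
    = {conept \<alpha> B | \<alpha> B. \<alpha> \<in> \<rat> \<and> \<alpha> > r \<and> B \<noteq> 0 \<and> cclass B \<in> {p, q}}"
  unfolding cone_eq rclass_in_Srestr_iff using cdet_roots by blast

lemma l_subset_QC: "\<rho> > 0 \<Longrightarrow> l \<subseteq> QC"
  unfolding l_eq using cdet_M(2) M_eq_0_iff by (auto simp: cclass_in_QC_iff)

lemma l_Int_QC:
  assumes "\<rho> = 0"
  shows "l \<inter> QC = {p, q}"
proof -
  have "cclass (M x y) \<in> QC \<longleftrightarrow> cclass (M x y) \<in> {p, q}" if "(x, y) \<noteq> (0, 0)" for x y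
    using that cdet_M(1)[OF assms] q0_eq_0_iff[OF that] M_eq_0_iff
    by (auto simp: cclass_in_QC_iff)
  then have *: "z \<in> QC \<longleftrightarrow> z \<in> {p, q}" if "z \<in> l" for z
    using that unfolding l_eq mem_Collect_eq by fast
  have "{p, q} \<subseteq> l" using p_in_l q_in_l by simp
  then show ?thesis using * by (simp only: set_eq_iff Int_iff subset_iff) fast
qed

lemma level_zero:
  assumes "\<rho> = 0"
  shows "kappa ` (l - {p, q})
    = {conept (of_rat \<rho>) (cscale (inverse (csqrt (q0 x y))) (M x y)) | x y. q0 x y \<noteq> 0}"
proof -
  have "kappa (cclass (M x y)) = conept (of_rat \<rho>) (cscale (inverse (csqrt (q0 x y))) (M x y))"
    if "q0 x y \<noteq> 0" for x y
    using kappa_cclass[of "M x y"] that cdet_M(1)[OF assms] assms by simp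
  moreover have "kappa ` (l - {p, q}) = {kappa (cclass (M x y)) | x y. q0 x y \<noteq> 0}"
    unfolding l_minus_eq by blast
  ultimately show ?thesis by (intro set_eqI) (simp only: mem_Collect_eq, metis)
qed

text \<open>A double zero means \<open>c0 = 0\<close>, so at \<open>\<rho> = 0\<close> the matrix
  \<open>A0\<close> is orthogonal for the polar form to the whole plane. Then
  \<open>g0 \<noteq> 0\<close> yields a point of the line off the quadric.\<close>

lemma tangent_l:
  assumes "\<rho> = 0" "p = q"
  shows "tangent_at l p" "\<not> l \<subseteq> QC"
proof -
  have "c0 = 0"
    using assms(2) unfolding p_eq q_def cclass_M_eq_iff by auto
  then have pol: "cpol A0 E0 = 0"
    using lt_forms c assms(1) unfolding lt_def by auto
  have "cpol X Y = 0" if P: "P \<in> l" "X \<in> p" "Y \<in> P" for P X Y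
  proof -
    obtain s where X: "X = cscale s A0" using \<open>X \<in> p\<close> unfolding p_def cclass_def by blast
    obtain x y t where "Y = cscale t (M x y)"
      using P(1,3) unfolding l_eq cclass_def by blast
    then have "Y = M (t * x) (t * y)" by (simp only: cscale_M)
    then obtain x y where Y: "Y = cscale x A0 + cscale y E0"
      unfolding M_def by blast
    have "cpol (cscale s A0) (cscale x A0 + cscale y E0)
        = 2 * s * x * cdet A0 + s * y * cpol A0 E0"
      by (cases A0; cases E0) (simp add: algebra_simps)
    then show ?thesis by (simp add: X Y pol cdet_A0)
  qed
  then show "tangent_at l p"
    unfolding tangent_at_def using is_cline_l p_in_l l_Int_QC[OF assms(1)] by blast
  have "g0 \<noteq> 0" using cg0 \<open>c0 = 0\<close> by simp
  then have "q0 0 1 \<noteq> 0" by (simp add: q0_def)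
  then have "cclass (M 0 1) \<in> l - {p, q}" unfolding l_minus_eq by blast
  then show "\<not> l \<subseteq> QC" using l_Int_QC[OF assms(1)] by blast
qed

section \<open>The section and its continuity\<close>

definition xc :: "cmat \<Rightarrow> complex" where "xc B = hdot A0 B / hdot A0 A0"
definition yc :: "cmat \<Rightarrow> complex" where "yc B = hdot E0 B / hdot E0 E0"

text \<open>The coordinates \<open>xc\<close> and \<open>yc\<close>, and with them
  \<open>qc\<close>, are defined on all matrices by orthogonal projection, not only on the plane of
  the line. Preimages are thus open in the full matrix space, as needed for open sets of
  \<open>CPtop\<close>.\<close>

definition qc :: "cmat \<Rightarrow> complex" where "qc B = q0 (xc B) (yc B)"

definition F :: "cmat \<Rightarrow> cmat" where
  "F B = cscale (inverse (csqrt (qc B))) (M (xc B) (yc B))"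

text \<open>A second branch of the root: $F$ and $F'$ agree up to sign, and each is continuous off one
  ray, so together they show that the class is continuous.\<close>

definition F' :: "cmat \<Rightarrow> cmat" where
  "F' B = cscale (inverse (\<i> * csqrt (- qc B))) (M (xc B) (yc B))"

definition \<sigma> :: "cmat set \<Rightarrow> cmat set" where
  "\<sigma> P = rclass (F (SOME B. B \<in> P))"

lemma coords_M: "xc (M x y) = x" "yc (M x y) = y"
  unfolding xc_def yc_def hdot_M using hdot_self_nonzero A0 E0 by simp_all

lemma coords_cscale: "xc (cscale s B) = s * xc B" "yc (cscale s B) = s * yc B"
  "qc (cscale s B) = s * s * qc B"
proof -
  show 1: "xc (cscale s B) = s * xc B" and 2: "yc (cscale s B) = s * yc B"
    by (simp_all add: xc_def yc_def hdot_linear)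
  show "qc (cscale s B) = s * s * qc B"
    unfolding qc_def 1 2 by (rule q0_scale)
qed

lemma rclass_F': "rclass (F' B) = rclass (F B)"
  unfolding F_def F'_def
proof (rule rclass_sign)
  have "(\<i> * csqrt (- qc B)) * (\<i> * csqrt (- qc B)) = (\<i> * \<i>) * (csqrt (- qc B) * csqrt (- qc B))"
    by (simp only: ac_simps)
  also have "\<dots> = qc B" unfolding csqrt_mult_self by simp
  finally show "inverse (\<i> * csqrt (- qc B)) * inverse (\<i> * csqrt (- qc B)) =
      inverse (csqrt (qc B)) * inverse (csqrt (qc B))"
    unfolding inverse_csqrt_square by (metis inverse_mult_distrib)
qed

text \<open>\<open>csqrt\<close> is not multiplicative, so only the squares of the two factors are
  compared; a sign is lost in the real class. This makes \<open>\<sigma>\<close> independent of the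
  representative chosen.\<close>

lemma rclass_F_cscale:
  assumes "s \<noteq> 0"
  shows "rclass (F (cscale s B)) = rclass (F B)"
proof -
  have "F (cscale s B) = cscale (inverse (csqrt (s * s * qc B)) * s) (M (xc B) (yc B))"
    unfolding F_def coords_cscale by (simp add: cscale_simps flip: cscale_M)
  moreover have "inverse (csqrt (s * s * qc B)) * s * (inverse (csqrt (s * s * qc B)) * s)
      = inverse (csqrt (qc B)) * inverse (csqrt (qc B))"
  proof -
    have "inverse (csqrt (s * s * qc B)) * s * (inverse (csqrt (s * s * qc B)) * s)
        = (inverse (csqrt (s * s * qc B)) * inverse (csqrt (s * s * qc B))) * (s * s)"
      by (simp only: ac_simps)
    also have "\<dots> = (inverse s * s) * (inverse s * s) * inverse (qc B)"
      unfolding inverse_csqrt_square inverse_mult_distrib by (simp only: ac_simps)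
    also have "\<dots> = inverse (qc B)"
      using left_inverse[OF assms] by simp
    finally show ?thesis
      unfolding inverse_csqrt_square .
  qed
  ultimately show ?thesis
    unfolding F_def[of B] by (metis rclass_sign)
qed

lemma \<sigma>_cclass: "\<sigma> (cclass B) = rclass (F B)"
proof -
  have "(SOME C. C \<in> cclass B) \<in> cclass B"
    by (rule someI[of _ "cscale 1 B"]) (unfold cclass_def, auto)
  then obtain s where "(SOME C. C \<in> cclass B) = cscale s B" "s \<noteq> 0"
    unfolding cclass_def by blast
  then show ?thesis
    unfolding \<sigma>_def by (simp add: rclass_F_cscale)
qed

lemma F_M: "F (M x y) = cscale (inverse (csqrt (q0 x y))) (M x y)"
  by (simp add: F_def qc_def coords_M)

lemma level_positive:
  "cone {of_rat \<rho>} (\<sigma> ` (l - {p, q}))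
    = {conept (of_rat \<rho>) (cscale (inverse (csqrt (q0 x y))) (M x y)) | x y. q0 x y \<noteq> 0}"
    (is "?L = ?R")
proof
  show "?L \<subseteq> ?R"
  proof
    fix Y assume "Y \<in> ?L"
    then obtain B x y where B: "Y = conept (of_rat \<rho>) B" "q0 x y \<noteq> 0"
      "rclass (F (M x y)) = rclass B"
      unfolding cone_eq l_minus_eq by (auto simp: \<sigma>_cclass)
    then obtain r where "r \<noteq> 0" "B = r *\<^sub>R F (M x y)"
      unfolding rclass_eq_iff by blast
    then have "Y = conept (of_rat \<rho>) (F (M x y))"
      using B by (simp add: conept_scaleR)
    then show "Y \<in> ?R" using B(2) unfolding F_M by blast
  qed
  show "?R \<subseteq> ?L"
  proof
    fix Y assume "Y \<in> ?R"
    then obtain x y where xy: "q0 x y \<noteq> 0" "Y = conept (of_rat \<rho>) (F (M x y))"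
      unfolding F_M by blast
    then have "cclass (M x y) \<in> l - {p, q}" unfolding l_minus_eq by blast
    then have "rclass (F (M x y)) \<in> \<sigma> ` (l - {p, q})" by (metis \<sigma>_cclass image_eqI)
    then show "Y \<in> ?L" unfolding cone_eq xy by blast
  qed
qed

lemma continuous_coords:
  "continuous_on S xc" "continuous_on S yc" "continuous_on S qc"
  "continuous_on S (\<lambda>B. M (xc B) (yc B))"
  unfolding xc_def[abs_def] yc_def[abs_def] qc_def[abs_def] q0_def M_def
  using hdot_self_nonzero[OF A0] hdot_self_nonzero[OF E0]
  by (auto intro!: continuous_intros)

text \<open>The assumption \<open>sat\<close> says that \<open>O'\<close> does not distinguish the
  two branches, so \<open>F\<close> may be exchanged for \<open>F'\<close> wherever
  \<open>csqrt (qc B)\<close> crosses its cut.\<close>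

lemma open_F_preimage:
  assumes "open O'" and sat: "\<And>B. qc B \<noteq> 0 \<Longrightarrow> F B \<in> O' \<longleftrightarrow> F' B \<in> O'"
  shows "open {B. qc B \<noteq> 0 \<and> F B \<in> O'}"
proof -
  let ?D = "{B. qc B \<notin> \<real>\<^sub>\<le>\<^sub>0}" and ?D' = "{B. - qc B \<notin> \<real>\<^sub>\<le>\<^sub>0}"
  have "open (qc -` (- \<real>\<^sub>\<le>\<^sub>0))" "open ((\<lambda>B. - qc B) -` (- \<real>\<^sub>\<le>\<^sub>0))"
    by (intro open_vimage continuous_intros continuous_coords; simp add: closed_nonpos_Reals_complex open_Compl)+
  then have D: "open ?D" "open ?D'" by (simp_all add: vimage_def)
  have sqrt: "continuous_on {B. f B \<notin> \<real>\<^sub>\<le>\<^sub>0} (\<lambda>B. csqrt (f B))"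
    if "continuous_on UNIV f" for f :: "cmat \<Rightarrow> complex"
    by (rule continuous_on_compose2[OF continuous_on_csqrt])
      (auto intro: continuous_on_subset[OF that])
  have "continuous_on ?D F"
    unfolding F_def[abs_def]
    by (intro continuous_intros continuous_coords sqrt) auto
  then have 1: "open (?D \<inter> F -` O')"
    using D(1) assms(1) by (rule continuous_open_preimage)
  have "continuous_on ?D' F'"
    unfolding F'_def[abs_def]
    by (intro continuous_intros continuous_coords sqrt) auto
  then have 2: "open (?D' \<inter> F' -` O')"
    using D(2) assms(1) by (rule continuous_open_preimage)
  \<comment> \<open>The two cuts meet only at zero.\<close>
  have "qc B \<noteq> 0 \<longleftrightarrow> B \<in> ?D \<or> B \<in> ?D'" for B
    by (auto simp: complex_nonpos_Reals_iff complex_eq_iff)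
  then have "{B. qc B \<noteq> 0 \<and> F B \<in> O'} = (?D \<inter> F -` O') \<union> (?D' \<inter> F' -` O')"
    using sat by blast
  then show ?thesis using open_Un[OF 1 2] by (simp only:)
qed

lemma is_section_\<sigma>:
  assumes "\<rho> > 0"
  shows "is_section \<sigma> (l - {p, q})"
proof -
  let ?Z = "l - {p, q}"
  let ?K = "{B. B \<noteq> 0 \<and> cdet B = 0}"
  have Z: "?Z \<subseteq> QC" using l_subset_QC[OF assms] by blast
  have FK: "F B \<in> ?K" "F' B \<in> ?K" if "qc B \<noteq> 0" for B
  proof -
    have "M (xc B) (yc B) \<noteq> 0" using that by (auto simp: M_eq_0_iff qc_def q0_def)
    then show "F B \<in> ?K" "F' B \<in> ?K"
      using that cdet_M(2)[OF assms] by (auto simp: F_def F'_def cscale_eq_0_iff cdet_cscale)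
  qed
  have sec: "\<sigma> z \<in> Sb \<and> piS (\<sigma> z) = z" if in_Z: "z \<in> ?Z" for z
  proof -
    obtain x y where z: "z = cclass (M x y)" "q0 x y \<noteq> 0"
      using in_Z unfolding l_minus_eq by blast
    have "cclass (F (M x y)) = cclass (M x y)"
      unfolding F_M using z by (intro cclass_cscale) simp
    moreover have "rclass (F (M x y)) \<in> Sb"
      using FK(1)[of "M x y"] z by (simp add: rclass_in_Sb_iff qc_def coords_M)
    ultimately show ?thesis using z by (simp add: \<sigma>_cclass piS_rclass)
  qed
  have ZCP: "?Z \<subseteq> topspace CPtop"
    using Z unfolding CPtop_def topspace_qtop QC_def by auto
  have "continuous_map (subtopology CPtop ?Z) Stop \<sigma>"
    unfolding continuous_map
  proof (intro conjI allI impI)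
    have "\<sigma> ` ?Z \<subseteq> topspace Stop"
      using sec unfolding Stop_def topspace_qtop Sb_def by blast
    then show "\<sigma> ` topspace (subtopology CPtop ?Z) \<subseteq> topspace Stop" by auto
    fix U assume "openin Stop U"
    then have "openin (top_of_set ?K) {x \<in> ?K. rclass x \<in> U}"
      unfolding Stop_def openin_qtop by blast
    then obtain O' where O': "open O'" "{x \<in> ?K. rclass x \<in> U} = ?K \<inter> O'"
      unfolding openin_open by blast
    \<comment> \<open>\<open>O'\<close> describes \<open>U\<close> only on rank one matrices, which
      is enough because \<open>F\<close> and \<open>F'\<close> take their values there.\<close>
    have FO: "F B \<in> O' \<longleftrightarrow> rclass (F B) \<in> U" "F' B \<in> O' \<longleftrightarrow> rclass (F' B) \<in> U" if "qc B \<noteq> 0" for B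
      using FK[OF that] O'(2) by blast+
    define \<Omega> where "\<Omega> = {B. qc B \<noteq> 0 \<and> F B \<in> O'}"
    have \<Omega>: "open \<Omega>"
      unfolding \<Omega>_def using FO rclass_F' by (intro open_F_preimage O') auto
    have \<Omega>_iff: "B \<in> \<Omega> \<longleftrightarrow> qc B \<noteq> 0 \<and> rclass (F B) \<in> U" for B
      unfolding \<Omega>_def using FO(1) by blast
    have "cscale s B \<in> \<Omega> \<longleftrightarrow> B \<in> \<Omega>" if "s \<noteq> 0" for s B
      unfolding \<Omega>_iff rclass_F_cscale[OF that] coords_cscale using that by simp
    \<comment> \<open>Invariance under complex scalars makes \<open>\<Omega>\<close> the full
      preimage of its image, so openness descends to the quotient.\<close>
    then have sat: "cclass B \<in> cclass ` \<Omega> \<longleftrightarrow> B \<in> \<Omega>" for B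
      unfolding image_iff cclass_eq_iff by (metis cscale_simps(4) zero_neq_one)
    have "0 \<notin> \<Omega>"
    proof -
      have "qc (cscale 0 0) = 0" unfolding coords_cscale by simp
      then show ?thesis by (simp add: \<Omega>_iff cscale_simps)
    qed
    then have "cclass ` \<Omega> \<subseteq> cclass ` (- {0})" "{x \<in> - {0}. cclass x \<in> cclass ` \<Omega>} = - {0} \<inter> \<Omega>"
      using sat by auto
    then have V: "openin CPtop (cclass ` \<Omega>)"
      unfolding CPtop_def openin_qtop using \<Omega> by (simp add: openin_open_Int)
    have "\<sigma> z \<in> U \<longleftrightarrow> z \<in> cclass ` \<Omega>" if in_Z: "z \<in> ?Z" for z
    proof -
      obtain x y where z: "z = cclass (M x y)" "q0 x y \<noteq> 0"
        using in_Z unfolding l_minus_eq by blast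
      then show ?thesis
        by (simp add: \<sigma>_cclass sat \<Omega>_iff qc_def coords_M)
    qed
    then have "{z \<in> topspace (subtopology CPtop ?Z). \<sigma> z \<in> U} = cclass ` \<Omega> \<inter> ?Z"
      using ZCP by auto
    then show "openin (subtopology CPtop ?Z) {z \<in> topspace (subtopology CPtop ?Z). \<sigma> z \<in> U}"
      using V by (auto simp: openin_subtopology)
  qed
  then show ?thesis
    unfolding is_section_def using Z sec by blast
qed

end

section \<open>The four cases, separated by \<open>\<rho> = 0\<close> and
  \<open>p = q\<close>\<close>

theorem theorem4p2:
  assumes "is_kline L" and "card (L \<inter> QK) = 2"
  shows "(\<exists>r l p q \<sigma>. r > 0 \<and> is_cline l \<and> l \<subseteq> QC \<and> p \<in> l \<and> q \<in> l \<and> p \<noteq> q \<and>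
            is_section \<sigma> (l - {p, q}) \<and>
            VALp ` L = cone {r} (\<sigma> ` (l - {p, q}))
                       \<union> cone {\<alpha>. r < \<alpha> \<and> \<alpha> \<in> \<rat>} (Srestr {p, q}) \<union> {p, q})
       \<or> (\<exists>l p q. is_cline l \<and> p \<noteq> q \<and> l \<inter> QC = {p, q} \<and>
            VALp ` L = kappa ` (l - {p, q})
                       \<union> cone {\<alpha>. 0 < \<alpha> \<and> \<alpha> \<in> \<rat>} (Srestr {p, q}) \<union> {p, q})
       \<or> (\<exists>r l p \<sigma>. r > 0 \<and> is_cline l \<and> l \<subseteq> QC \<and> p \<in> l \<and>
            is_section \<sigma> (l - {p}) \<and>
            VALp ` L = cone {r} (\<sigma> ` (l - {p}))
                       \<union> cone {\<alpha>. r < \<alpha> \<and> \<alpha> \<in> \<rat>} (Srestr {p}) \<union> {p})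
       \<or> (\<exists>l p. tangent_at l p \<and> \<not> l \<subseteq> QC \<and>
            VALp ` L = kappa ` (l - {p})
                       \<union> cone {\<alpha>. 0 < \<alpha> \<and> \<alpha> \<in> \<rat>} (Srestr {p}) \<union> {p})"
proof -
  obtain A E A0 E0 c g \<rho> c0 g0 where "adapted_line A E A0 E0 c g \<rho> c0 g0" and L: "L = pline A E"
    using ex_adapted_line[OF assms] .
  then interpret adapted_line A E A0 E0 c g \<rho> c0 g0 by blast
  show ?thesis
  proof (cases "\<rho> = 0")
    case True
    have val: "VALp ` L = kappa ` (l - {p, q})
        \<union> cone {\<alpha>. 0 < \<alpha> \<and> \<alpha> \<in> \<rat>} (Srestr {p, q}) \<union> {p, q}"
      unfolding L VALp_image cone_part level_zero[OF True] using True by simp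
    show ?thesis
    proof (cases "p = q")
      case eq: True
      then have "{p, q} = {p}" by simp
      note val' = val[unfolded this]
      show ?thesis
        by (intro disjI2 exI[of _ l] exI[of _ p] conjI) (fact tangent_l[OF True eq] val')+
    next
      case False
      show ?thesis
        by (rule disjI2, rule disjI1, intro exI[of _ l] exI[of _ p] exI[of _ q] conjI)
          (fact is_cline_l False l_Int_QC[OF True] val)+
    qed
  next
    case False
    then have pos: "\<rho> > 0" using rho_nonneg by simp
    then have r: "(of_rat \<rho> :: real) > 0" by simp
    have val: "VALp ` L = cone {of_rat \<rho>} (\<sigma> ` (l - {p, q}))
        \<union> cone {\<alpha>. of_rat \<rho> < \<alpha> \<and> \<alpha> \<in> \<rat>} (Srestr {p, q}) \<union> {p, q}"
      unfolding L VALp_image cone_part level_positive ..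
    show ?thesis
    proof (cases "p = q")
      case True
      then have eq: "{p, q} = {p}" by simp
      show ?thesis
        by (rule disjI2, rule disjI2, rule disjI1,
            intro exI[of _ "of_rat \<rho>"] exI[of _ l] exI[of _ p] exI[of _ \<sigma>] conjI)
          (fact r is_cline_l l_subset_QC[OF pos] p_in_l
            is_section_\<sigma>[OF pos, unfolded eq] val[unfolded eq])+
    next
      case False
      show ?thesis
        by (rule disjI1, intro exI[of _ "of_rat \<rho>"] exI[of _ l] exI[of _ p] exI[of _ q]
            exI[of _ \<sigma>] conjI)
          (fact r is_cline_l l_subset_QC[OF pos] p_in_l q_in_l False is_section_\<sigma>[OF pos] val)+
    qed
  qed
qed

end
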